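(* Let $U:\mathbb Z\to\mathbb R$ and, for all $\varepsilon>0$, let $(X^\varepsilon_k,V^\varepsilon_k)_{k\in\mathbb N}$ be the Zig-Zag walk (persistent walk) on $\mathbb Z$ associated to $U/\varepsilon$, with initial condition $(0,1)$. Suppose that $U(0)=0$ and that $U$ is nonincreasing on $\{x\in\mathbb Z:x\leqslant0\}$ and nondecreasing on $\{x\in\mathbb Z:x\geqslant0\}$. Let $a<\alpha\leqslant0\leqslant\beta<b$ be integers such that $\{k\in\mathbb Z:\alpha\leqslant k\leqslant\beta\}=\{k\in\mathbb Z: U(k)=0\}$, and let $$\tau_\varepsilon=\inf\{n\in\mathbb N:\ X_n^\varepsilon\leqslant a\text{ or }X_n^\varepsilon\geqslant b\}.$$ Set $E_1=\min(U(a),U(b))$, $E_2=\min(U(\alpha-1),U(\beta+1))$ and $E_3=|U(a)-U(b)|$. Then, as $\varepsilon\to0$, $$\mathbb E(\tau_\varepsilon)=e^{E_1/\varepsilon}\left(\frac{2(\beta-\alpha+1)}{1+\mathbf 1_{U(a)=U(b)}}+\mathcal O\big(e^{-E_2/\varepsilon}\big)+\mathbf 1_{U(a)\neq U(b)}\,\mathcal O\big(e^{-E_3/\varepsilon}\big)\right).$$ Moreover, $\tau_\varepsilon/\mathbb E(\tau_\varepsilon)$ converges in law as $\varepsilon\to0$ to an exponential random variable with parameter $1$, and $$\mathbb P(X^\varepsilon_{\tau_\varepsilon}=a)\ \underset{\varepsilon\to0}{\longrightarrow}\ \frac12\Big(1+\mathbf 1_{U(a)\leqslant U(b)}-\mathbf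 1_{U(b)\leqslant U(a)}\Big).$$ Finally, for all $\varepsilon>0$, $$2(\beta-\alpha+1)(G_\varepsilon-1)\ \overset{sto}{\leqslant}\ \tau_\varepsilon\ \overset{sto}{\leqslant}\ 2(b-a+1)G_\varepsilon,$$ where $G_\varepsilon$ is a geometric random variable with parameter $e^{-U(b)/\varepsilon}+e^{-U(a)/\varepsilon}-e^{-(U(b)+U(a))/\varepsilon}$.
   Context: For $r\in\mathbb R$, $(r)_+=\max(r,0)$. For a potential $W:\mathbb Z\to\mathbb R$, the Zig-Zag (or persistent) walk on $\mathbb Z$ associated to $W$ is the Markov chain on $\mathbb Z\times\{-1,1\}$ with transitions: from $(x,v)$, move to $(x+v,v)$ with probability $\min(e^{W(x)-W(x+v)},1)=e^{-(W(x+v)-W(x))_+}$, and to $(x,-v)$ otherwise. A real random variable $G$ is stochastically larger than a real random variable $F$, written $F\overset{sto}{\leqslant}G$, if $\mathbb P(G<t)\leqslant\mathbb P(F<t)$ for all $t\in\mathbb R$. A geometric random variable with parameter $p\in(0,1]$ takes values in $\{1,2,\dots\}$ with $\mathbb P(G=k)=p(1-p)^{k-1}$. *)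

theory Defs
  imports "HOL-Probability.Probability" "HOL-Library.Landau_Symbols"
begin

(* Time-homogeneous Markov chain on the countable state space S.  Nothing is said about the
   initial law; conditioning is only on trajectories of positive probability. *)
definition markov_chain ::
  "'a measure \<Rightarrow> 's set \<Rightarrow> ('s \<Rightarrow> 's pmf) \<Rightarrow> (nat \<Rightarrow> 'a \<Rightarrow> 's) \<Rightarrow> bool" where
  "markov_chain M S K Z \<longleftrightarrow>
     prob_space M \<and>
     (\<forall>n. Z n \<in> measurable M (count_space S)) \<and>
     (\<forall>n z z'. \<P>(\<omega> in M. \<forall>i\<le>n. Z i \<omega> = z i) > 0 \<longrightarrow>
        \<P>(\<omega> in M. Z (Suc n) \<omega> = z' \<bar> \<forall>i\<le>n. Z i \<omega> = z i) = pmf (K (z n)) z')"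

definition zigzag_kernel :: "(int \<Rightarrow> real) \<Rightarrow> int \<times> int \<Rightarrow> (int \<times> int) pmf" where
  "zigzag_kernel W = (\<lambda>(x, v).
     map_pmf (\<lambda>move. if move then (x + v, v) else (x, - v))
       (bernoulli_pmf (min (exp (W x - W (x + v))) 1)))"

definition zigzag_walk ::
  "'a measure \<Rightarrow> (int \<Rightarrow> real) \<Rightarrow> (nat \<Rightarrow> 'a \<Rightarrow> int) \<Rightarrow> (nat \<Rightarrow> 'a \<Rightarrow> int) \<Rightarrow> bool" where
  "zigzag_walk M W X V \<longleftrightarrow>
     markov_chain M (UNIV \<times> {-1, 1}) (zigzag_kernel W) (\<lambda>n \<omega>. (X n \<omega>, V n \<omega>))"

(* Equals \<infinity> if the path x never leaves {a<..<b}, since the infimum of {} in enat is \<infinity>. *)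
definition exit_time :: "int \<Rightarrow> int \<Rightarrow> (nat \<Rightarrow> int) \<Rightarrow> enat" where
  "exit_time a b x = Inf (enat ` {n. x n \<le> a \<or> b \<le> x n})"

(* F on M is stochastically smaller than G on N.  Values are extended real because a hitting
   time may be infinite; the two variables may live on different probability spaces. *)
definition sto_le :: "'a measure \<Rightarrow> ('a \<Rightarrow> ereal) \<Rightarrow> 'b measure \<Rightarrow> ('b \<Rightarrow> ereal) \<Rightarrow> bool" where
  "sto_le M F N G \<longleftrightarrow>
     (\<forall>t::real. \<P>(\<omega> in N. G \<omega> < ereal t) \<le> \<P>(\<omega> in M. F \<omega> < ereal t))"

(* Values start at 1, unlike those of geometric_pmf. *)
definition geometric_rv :: "'b measure \<Rightarrow> ('b \<Rightarrow> nat) \<Rightarrow> real \<Rightarrow> bool" where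
  "geometric_rv N G p \<longleftrightarrow>
     prob_space N \<and>
     G \<in> measurable N (count_space {1..}) \<and>
     (\<forall>k\<ge>1. \<P>(\<omega> in N. G \<omega> = k) = p * (1 - p) ^ (k - 1))"

end

(* Between two visits of (0, 1) the walk makes one excursion on each side of the plateau.
   Descents are deterministic and the acceptance probabilities telescope along an ascent, so an
   excursion to the right exits at b with probability exp (- U b / eps), independently of the
   past, and otherwise turns back at height y and lasts 2 y + 1 steps. Conditioning on the first
   excursion gives a renewal equation for the survival function n |-> P(tau > n). It bounds the
   survival function by geometric tails from both sides, and summing it over n gives the exact
   mean; the same one-step analysis gives the exit law.

   The geometric lower bound has asymptotically the same mean as tau. Being monotone, the
   survival function cannot stay away from a lower bound with the same mean, so tau has the same
   limit law as 2 (beta - alpha + 1) times the geometric variable. *)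
theory Submission
  imports Defs "HOL-Real_Asymp.Real_Asymp"
begin

subsection \<open>Path laws of Markov chains\<close>

text \<open>No independent cycles and no strong Markov property are set up. The chain enters only
  through the laws of its finite paths, \<open>path_pmf\<close>; after that, survival probabilities
  from (0, 1) and (0, -1) are plain functions of time that satisfy recursions.

  The constant 2 (beta - alpha + 1) comes from the plateau. Every step inside it is accepted, so a
  loop, that is one returning excursion on each side, takes at least (2 beta + 1) + (2 (-alpha) + 1)
  steps, and leaving the plateau has probability O(e^(-E2/eps)). The shortest loop and the mean loop
  thus have the same length up to this error. This is why the geometric lower bound is sharp in the
  limit, unlike the upper one, which is governed by the longest loop.

  The exact mean is the mean length of a loop stopped at the exit, divided by the probability p that
  a loop exits. With D = max (U a) (U b) one has p = e^(-E1/eps) (1 + e^(-E3/eps) - e^(-D/eps)). The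
  middle term is 1 in a tie and small otherwise, whence the factor 1 + 1_{U(a)=U(b)} and the error
  in E3.\<close>

primrec path_pmf :: "('s \<Rightarrow> 's pmf) \<Rightarrow> nat \<Rightarrow> 's \<Rightarrow> 's list pmf" where
  "path_pmf K 0 z = return_pmf [z]"
| "path_pmf K (Suc n) z = bind_pmf (K z) (\<lambda>z'. map_pmf ((#) z) (path_pmf K n z'))"

lemma Nil_notin_path_pmf: "[] \<notin> set_pmf (path_pmf K n z)"
  by (cases n) auto

text \<open>The definition peels off the first step, which suits one-step analysis, whereas
  \<open>markov_chain\<close> describes the last step given the past. This identity connects the
  two.\<close>

lemma path_pmf_snoc:
  "path_pmf K (Suc n) z =
     bind_pmf (path_pmf K n z) (\<lambda>zs. map_pmf (\<lambda>z'. zs @ [z']) (K (last zs)))"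
proof (induction n arbitrary: z)
  case 0
  show ?case
    by (simp add: bind_return_pmf map_pmf_def)
next
  case (Suc n)
  have "path_pmf K (Suc (Suc n)) z =
      bind_pmf (K z) (\<lambda>z'. bind_pmf (path_pmf K n z')
        (\<lambda>zs. map_pmf ((#) z \<circ> (\<lambda>y. zs @ [y])) (K (last zs))))"
    by (subst path_pmf.simps(2), subst Suc)
       (simp add: map_bind_pmf pmf.map_comp)
  \<comment> \<open>Paths are never empty, so \<open>last (z # zs) = last zs\<close>.\<close>
  also have "\<dots> = bind_pmf (K z) (\<lambda>z'. bind_pmf (path_pmf K n z')
        (\<lambda>zs. map_pmf (\<lambda>y. (z # zs) @ [y]) (K (last (z # zs)))))"
    by (intro bind_pmf_cong refl) (use Nil_notin_path_pmf in \<open>fastforce simp: comp_def\<close>)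
  also have "\<dots> = bind_pmf (path_pmf K (Suc n) z)
        (\<lambda>zs. map_pmf (\<lambda>z'. zs @ [z']) (K (last zs)))"
    by (simp add: bind_assoc_pmf bind_map_pmf)
  finally show ?case .
qed

lemma pmf_path_snoc:
  "pmf (path_pmf K (Suc n) z) (ws @ [w]) = pmf (path_pmf K n z) ws * pmf (K (last ws)) w"
proof -
  have "pmf (map_pmf (\<lambda>z'. zs @ [z']) (K (last zs))) (ws @ [w])
      = indicator {ws} zs * pmf (K (last ws)) w" for zs
  proof (cases "zs = ws")
    case True
    then show ?thesis
      using pmf_map_inj'[of "\<lambda>z'. ws @ [z']" "K (last ws)" w] by (simp add: inj_def)
  next
    case False
    then have "ws @ [w] \<notin> set_pmf (map_pmf (\<lambda>z'. zs @ [z']) (K (last zs)))"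
      by auto
    with False show ?thesis
      by (simp only: set_pmf_iff indicator_simps) simp
  qed
  then have "pmf (path_pmf K (Suc n) z) (ws @ [w])
      = (\<integral>zs. indicator {ws} zs * pmf (K (last ws)) w \<partial>measure_pmf (path_pmf K n z))"
    by (simp only: path_pmf_snoc pmf_bind)
  then show ?thesis
    by (simp add: measure_pmf_single)
qed

lemma length_path_pmf: "zs \<in> set_pmf (path_pmf K n z) \<Longrightarrow> length zs = Suc n"
  by (induction n arbitrary: z zs) auto

lemma nth_map_upt_eq_iff:
  "map f [0..<n] = zs \<longleftrightarrow> length zs = n \<and> (\<forall>i<n. f i = zs ! i)"
  by (auto simp: list_eq_iff_nth_eq)

lemma measurable_path:
  fixes Z :: "nat \<Rightarrow> 'a \<Rightarrow> 's :: countable"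
  assumes [measurable]: "\<And>i. Z i \<in> measurable M (count_space UNIV)"
  shows "(\<lambda>\<omega>. map (\<lambda>i. Z i \<omega>) [0..<n]) \<in> measurable M (count_space UNIV)"
proof (subst measurable_count_space_eq2_countable, safe)
  fix zs
  have "(\<lambda>\<omega>. map (\<lambda>i. Z i \<omega>) [0..<n]) -` {zs} \<inter> space M
      = {\<omega> \<in> space M. length zs = n \<and> (\<forall>i<n. Z i \<omega> = zs ! i)}"
    by (auto simp: nth_map_upt_eq_iff)
  also have "\<dots> \<in> sets M"
    by measurable
  finally show "(\<lambda>\<omega>. map (\<lambda>i. Z i \<omega>) [0..<n]) -` {zs} \<inter> space M \<in> sets M" .
qed auto

lemma markov_chain_measurable:
  "markov_chain M S K Z \<Longrightarrow> Z i \<in> measurable M (count_space UNIV)"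
  by (auto simp: markov_chain_def intro: measurable_compose[where g = "\<lambda>x. x"])

text \<open>On a countable type the probabilities of single paths determine the law, and these are
  built up by one last step at a time, as in \<open>pmf_path_snoc\<close>.\<close>

lemma markov_chain_path_law:
  fixes Z :: "nat \<Rightarrow> 'a \<Rightarrow> 's :: countable"
  assumes mc: "markov_chain M S K Z" and init: "AE \<omega> in M. Z 0 \<omega> = z0"
  shows "distr M (count_space UNIV) (\<lambda>\<omega>. map (\<lambda>i. Z i \<omega>) [0..<Suc n])
      = measure_pmf (path_pmf K n z0)"
proof -
  interpret prob_space M
    using mc by (simp add: markov_chain_def)
  note Z[measurable] = markov_chain_measurable[OF mc]
  let ?L = "\<lambda>n \<omega>. map (\<lambda>i. Z i \<omega>) [0..<Suc n]"
  have path_eq: "?L n \<omega> = zs \<longleftrightarrow> length zs = Suc n \<and> (\<forall>i\<le>n. Z i \<omega> = zs ! i)" for n \<omega> zs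
    by (simp only: nth_map_upt_eq_iff less_Suc_eq_le)
  have L[measurable]: "?L n \<in> measurable M (count_space UNIV)" for n
    by (rule measurable_path[OF Z])
  have single: "\<P>(\<omega> in M. ?L n \<omega> = zs) = pmf (path_pmf K n z0) zs" for n zs
  proof (induction n arbitrary: zs)
    case 0
    show ?case
    proof (cases "zs = [z0]")
      case True
      have "AE \<omega> in M. ?L 0 \<omega> = zs"
        using init by eventually_elim (simp add: True)
      then show ?thesis
        using True by (simp add: prob_Collect_eq_1)
    next
      case False
      have "AE \<omega> in M. ?L 0 \<omega> \<noteq> zs"
        using init by eventually_elim (use False in auto)
      then show ?thesis
        using False by (simp add: prob_Collect_eq_0)
    qed
  next
    case (Suc n)
    show ?case
    proof (cases "length zs = Suc (Suc n)")
      case True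
      then obtain ws w where zs: "zs = ws @ [w]" and len: "length ws = Suc n"
        by (cases zs rule: rev_cases) auto
      have last: "last ws = ws ! n"
        using len by (metis last_conv_nth diff_Suc_1 list.size(3) nat.distinct(1))
      let ?P = "\<lambda>\<omega>. \<forall>i\<le>n. Z i \<omega> = ws ! i"
      have ev: "{\<omega> \<in> space M. ?L (Suc n) \<omega> = zs} = {\<omega> \<in> space M. Z (Suc n) \<omega> = w \<and> ?P \<omega>}"
        using path_eq[of _ n ws] len unfolding zs by auto
      have IH: "\<P>(\<omega> in M. ?P \<omega>) = pmf (path_pmf K n z0) ws"
        using Suc[of ws] path_eq[of _ n ws] len by simp
      have "\<P>(\<omega> in M. Z (Suc n) \<omega> = w \<and> ?P \<omega>) = \<P>(\<omega> in M. ?P \<omega>) * pmf (K (ws ! n)) w"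
      proof (cases "\<P>(\<omega> in M. ?P \<omega>) > 0")
        case True
        then have "\<P>(\<omega> in M. Z (Suc n) \<omega> = w \<bar> ?P \<omega>) = pmf (K (ws ! n)) w"
          using mc unfolding markov_chain_def by auto
        with True show ?thesis
          by (simp add: cond_prob_def field_simps)
      next
        \<comment> \<open>After a null prefix \<open>markov_chain\<close> promises nothing, but then
          both sides vanish.\<close>
        case False
        then have "\<P>(\<omega> in M. ?P \<omega>) = 0"
          by (simp add: zero_less_measure_iff)
        moreover have "\<P>(\<omega> in M. Z (Suc n) \<omega> = w \<and> ?P \<omega>) \<le> \<P>(\<omega> in M. ?P \<omega>)"
          by (intro finite_measure_mono) auto
        ultimately show ?thesis
          by (simp add: measure_le_0_iff)
      qed
      then show ?thesis
        unfolding ev unfolding zs pmf_path_snoc last IH .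
    next
      case False
      then have "zs \<notin> set_pmf (path_pmf K (Suc n) z0)"
        using length_path_pmf[of zs K "Suc n" z0] by auto
      moreover have "{\<omega> \<in> space M. ?L (Suc n) \<omega> = zs} = {}"
        using False path_eq by blast
      ultimately show ?thesis
        by (simp only: set_pmf_iff measure_empty) simp
    qed
  qed
  show ?thesis
  proof (rule measure_eqI_countable[of _ UNIV])
    fix zs
    have "?L n -` {zs} \<inter> space M = {\<omega> \<in> space M. ?L n \<omega> = zs}"
      by auto
    then show "emeasure (distr M (count_space UNIV) (?L n)) {zs}
        = emeasure (measure_pmf (path_pmf K n z0)) {zs}"
      using single[of n zs] by (simp add: emeasure_distr emeasure_eq_measure emeasure_pmf_single
          del: upt_Suc)
  qed auto
qed

lemma markov_chain_path_prob:
  fixes Z :: "nat \<Rightarrow> 'a \<Rightarrow> 's :: countable"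
  assumes "markov_chain M S K Z" and "AE \<omega> in M. Z 0 \<omega> = z0"
  shows "\<P>(\<omega> in M. Q (map (\<lambda>i. Z i \<omega>) [0..<Suc n]))
      = measure_pmf.prob (path_pmf K n z0) {zs. Q zs}"
proof -
  let ?L = "\<lambda>\<omega>. map (\<lambda>i. Z i \<omega>) [0..<Suc n]"
  have L: "?L \<in> measurable M (count_space UNIV)"
    by (intro measurable_path markov_chain_measurable[OF assms(1)])
  have "measure_pmf.prob (path_pmf K n z0) {zs. Q zs} = measure M (?L -` {zs. Q zs} \<inter> space M)"
    unfolding markov_chain_path_law[OF assms, of n, symmetric]
    by (rule measure_distr[OF L]) simp
  also have "?L -` {zs. Q zs} \<inter> space M = {\<omega> \<in> space M. Q (?L \<omega>)}"
    by auto
  finally show ?thesis by simp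
qed

subsection \<open>Excursions\<close>

text \<open>\<open>R n x\<close> and \<open>L n x\<close> are the probabilities of surviving \<open>n\<close> steps from distance \<open>x\<close> to the
  origin when moving outwards and inwards, and \<open>e x\<close> is the exponential of minus the potential.
  Multiplying by \<open>e x\<close> clears the denominator of the acceptance probability.\<close>
lemma excursion_renewal:
  fixes R L :: "nat \<Rightarrow> nat \<Rightarrow> real" and e :: "nat \<Rightarrow> real"
  assumes R0: "\<And>x. x < B \<Longrightarrow> R 0 x = 1" and L0: "\<And>x. x < B \<Longrightarrow> L 0 x = 1"
    and RB: "\<And>n. R n B = 0"
    and R_Suc: "\<And>n x. x < B \<Longrightarrow>
      e x * R (Suc n) x = e (Suc x) * R n (Suc x) + (e x - e (Suc x)) * L n x"
    and L_Suc: "\<And>n x. Suc x < B \<Longrightarrow> L (Suc n) (Suc x) = L n x"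
    and "x \<le> B"
  shows "e x * R n x = (\<Sum>y=x..<B. (e y - e (Suc y)) * L (n - (2 * y - x + 1)) 0)
      + (if n < B - x then e B else 0)"
proof -
  \<comment> \<open>Inward steps are always accepted, so a descent from \<open>x\<close> takes
    exactly \<open>x\<close> steps. For \<open>n < x\<close> truncated subtraction gives
    \<open>L 0 0 = 1\<close>, the right value because nothing can go wrong on the way down.\<close>
  have descent: "L n x = L (n - x) 0" if "x < B" for n x
    using that
  proof (induction x arbitrary: n)
    case (Suc x)
    show ?case
    proof (cases n)
      case 0
      then show ?thesis using L0 Suc.prems by simp
    next
      case (Suc m)
      then show ?thesis using L_Suc Suc.IH Suc.prems by simp
    qed
  qed simp
  show ?thesis
    using \<open>x \<le> B\<close>
  proof (induction arbitrary: n rule: inc_induct)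
    case base
    then show ?case by (simp add: RB)
  next
    case (step x)
    show ?case
    proof (cases n)
      case 0
      \<comment> \<open>At time 0 the turning weights telescope to \<open>e x - e B\<close>, and the
        exit weight \<open>e B\<close> completes them to \<open>e x\<close>.\<close>
      have "(\<Sum>y=x..<B. (e y - e (Suc y)) * L 0 0) = (\<Sum>y=x..<B. e y - e (Suc y))"
        using L0[of 0] step.hyps by simp
      also have "\<dots> = e x - e B"
        using sum_Suc_diff'[of x B "\<lambda>y. - e y"] step.hyps by simp
      finally show ?thesis
        using 0 R0 step.hyps by simp
    next
      case (Suc m)
      have "e x * R n x = e (Suc x) * R m (Suc x) + (e x - e (Suc x)) * L (m - x) 0"
        using R_Suc[of x m] descent[of x m] step.hyps Suc by simp
      also have "e (Suc x) * R m (Suc x)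
          = (\<Sum>y=Suc x..<B. (e y - e (Suc y)) * L (m - (2 * y - Suc x + 1)) 0)
            + (if m < B - Suc x then e B else 0)"
        by (rule step.IH)
      also have "(\<Sum>y=Suc x..<B. (e y - e (Suc y)) * L (m - (2 * y - Suc x + 1)) 0)
          = (\<Sum>y=Suc x..<B. (e y - e (Suc y)) * L (n - (2 * y - x + 1)) 0)"
      proof (intro sum.cong refl)
        fix y assume "y \<in> {Suc x..<B}"
        then have "m - (2 * y - Suc x + 1) = n - (2 * y - x + 1)"
          using Suc by auto
        then show "(e y - e (Suc y)) * L (m - (2 * y - Suc x + 1)) 0
            = (e y - e (Suc y)) * L (n - (2 * y - x + 1)) 0" by simp
      qed
      also have "(if m < B - Suc x then e B else 0) = (if n < B - x then e B else 0)"
        using Suc by auto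
      \<comment> \<open>Turning back at once is the term \<open>y = x\<close>: one step for the flip
        and \<open>x\<close> for the descent.\<close>
      also have "m - x = n - (2 * x - x + 1)"
        using Suc by simp
      finally show ?thesis
        using step.hyps by (subst sum.atLeast_Suc_lessThan) simp_all
    qed
  qed
qed

text \<open>\<open>L\<close> is constant along a descent, so the recursion says that
  \<open>e x * (R x - L 0)\<close> does not depend on the height; compare \<open>x\<close> with
  \<open>B\<close>.\<close>

lemma excursion_hitting:
  fixes R L :: "nat \<Rightarrow> real" and e :: "nat \<Rightarrow> real"
  assumes R: "\<And>x. x < B \<Longrightarrow> e x * R x = e (Suc x) * R (Suc x) + (e x - e (Suc x)) * L x"
    and L: "\<And>x. Suc x < B \<Longrightarrow> L (Suc x) = L x"
    and "x \<le> B"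
  shows "e x * R x = (e x - e B) * L 0 + e B * R B"
proof -
  have L0: "L x = L 0" if "x < B" for x
    using that by (induction x) (simp_all add: L)
  show ?thesis
    using \<open>x \<le> B\<close>
  proof (induction rule: inc_induct)
    case (step x)
    then show ?case
      using R[of x] L0[of x] by (simp add: algebra_simps)
  qed simp
qed

text \<open>The truncated shift repeats \<open>g 0 = 1\<close> another \<open>k\<close> times at the
  front, and the terms that it pushes past \<open>N\<close> are nonnegative.\<close>

lemma sum_shift_le:
  fixes g :: "nat \<Rightarrow> real"
  assumes "\<And>n. 0 \<le> g n" "g 0 = 1"
  shows "(\<Sum>n<N. g (n - k)) \<le> real k + (\<Sum>n<N. g n)"
proof (induction k)
  case (Suc k)
  have "(\<Sum>n<N. g (n - Suc k)) \<le> 1 + (\<Sum>n<N. g (n - k))"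
  proof (cases N)
    case 0
    then show ?thesis by simp
  next
    case N: (Suc M)
    have "(\<Sum>n<Suc M. g (n - Suc k)) = 1 + (\<Sum>n<M. g (n - k))"
      by (subst sum.lessThan_Suc_shift) (simp add: assms)
    also have "(\<Sum>n<M. g (n - k)) \<le> (\<Sum>n<Suc M. g (n - k))"
      using assms(1) by simp
    finally show ?thesis
      using N by simp
  qed
  with Suc show ?case by simp
qed simp

lemma sums_shift:
  fixes g :: "nat \<Rightarrow> real"
  assumes "g sums s" "g 0 = 1"
  shows "(\<lambda>n. g (n - k)) sums (real k + s)"
proof (induction k)
  case (Suc k)
  have "(\<lambda>n. g (Suc n - Suc k)) sums (real k + s)"
    using Suc by simp
  then show ?case
    by (subst (asm) sums_Suc_iff) (simp add: assms algebra_simps)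
qed (use assms in simp)

text \<open>\<open>f\<close> and \<open>g\<close> are the survival functions started at the origin, before and after an
  excursion of height at most \<open>B\<close>: the excursion turns back at height \<open>y\<close> with probability
  \<open>r y\<close> and then lasts \<open>2 * y + 1\<close> steps. Since \<open>g 0 = 1\<close>, truncated subtraction gives the
  right value when the time \<open>n\<close> is reached during the excursion.\<close>
locale excursion =
  fixes f g r :: "nat \<Rightarrow> real" and q :: real and B :: nat
  assumes renewal: "f n = (\<Sum>y<B. r y * g (n - (2 * y + 1))) + (if n < B then q else 0)"
    and r_nonneg: "y < B \<Longrightarrow> 0 \<le> r y" and q_nonneg: "0 \<le> q"
    and sum_r: "(\<Sum>y<B. r y) = 1 - q"
    and g_nonneg: "0 \<le> g n" and g_0: "g 0 = 1" and g_antimono: "antimono g"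
begin

text \<open>The mean duration of one excursion stopped at the exit: with probability
  \<open>q\<close> it consists of \<open>B\<close> outward steps only.\<close>

definition mean_length :: real where
  "mean_length = (\<Sum>y<B. r y * real (2 * y + 1)) + real B * q"

text \<open>If no turn happens below height \<open>m\<close>, each returning excursion uses at least
  \<open>2 * m + 1\<close> steps. The exiting paths are dropped.\<close>

lemma lower:
  assumes "\<And>y. y < B \<Longrightarrow> y < m \<Longrightarrow> r y = 0"
  shows "(1 - q) * g (n - (2 * m + 1)) \<le> f n"
proof -
  have "(1 - q) * g (n - (2 * m + 1)) = (\<Sum>y<B. r y * g (n - (2 * m + 1)))"
    by (simp add: sum_r[symmetric] sum_distrib_right)
  also have "\<dots> \<le> (\<Sum>y<B. r y * g (n - (2 * y + 1)))"
  proof (intro sum_mono)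
    fix y assume y: "y \<in> {..<B}"
    show "r y * g (n - (2 * m + 1)) \<le> r y * g (n - (2 * y + 1))"
    proof (cases "y < m")
      case True
      then show ?thesis using assms y by simp
    next
      case False
      then show ?thesis
        using y r_nonneg by (intro mult_left_mono antimonoD[OF g_antimono]) auto
    qed
  qed
  also have "\<dots> \<le> f n"
    unfolding renewal[of n] using q_nonneg by simp
  finally show ?thesis .
qed

text \<open>The longest returning excursion turns at height \<open>B - 1\<close>, and from time
  \<open>B\<close> on no path is still on its way to the exit.\<close>

lemma upper:
  assumes "B \<le> n"
  shows "f n \<le> (1 - q) * g (n - (2 * B - 1))"
proof -
  have "f n = (\<Sum>y<B. r y * g (n - (2 * y + 1)))"
    using assms renewal[of n] by simp
  also have "\<dots> \<le> (\<Sum>y<B. r y * g (n - (2 * B - 1)))"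
    by (intro sum_mono mult_left_mono antimonoD[OF g_antimono]) (auto intro: r_nonneg)
  also have "\<dots> = (1 - q) * g (n - (2 * B - 1))"
    by (simp add: sum_r[symmetric] sum_distrib_right)
  finally show ?thesis .
qed

lemma sum_exit: "(\<Sum>n<N. if n < B then q else 0) \<le> real B * q"
proof -
  have "(\<Sum>n<N. if n < B then q else 0) = (\<Sum>n\<in>{..<N} \<inter> {..<B}. q)"
    by (subst sum.inter_restrict) auto
  also have "\<dots> = real (min N B) * q"
  proof -
    have "{..<N} \<inter> {..<B} = {..<min N B}" by auto
    then show ?thesis by simp
  qed
  also have "\<dots> \<le> real B * q"
    by (intro mult_right_mono) (use q_nonneg in auto)
  finally show ?thesis .
qed

text \<open>Stated for partial sums because it will serve to prove summability; \<open>sums\<close>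
  is the exact version available afterwards.\<close>

lemma partial_sum_le: "(\<Sum>n<N. f n) \<le> mean_length + (1 - q) * (\<Sum>n<N. g n)"
proof -
  have "(\<Sum>n<N. f n) = (\<Sum>y<B. r y * (\<Sum>n<N. g (n - (2 * y + 1))))
      + (\<Sum>n<N. if n < B then q else 0)"
    unfolding renewal sum.distrib by (subst sum.swap) (simp add: sum_distrib_left)
  also have "\<dots> \<le> (\<Sum>y<B. r y * (real (2 * y + 1) + (\<Sum>n<N. g n))) + real B * q"
    by (intro add_mono sum_mono mult_left_mono sum_shift_le sum_exit)
       (auto simp: g_nonneg g_0 r_nonneg)
  also have "\<dots> = mean_length + (1 - q) * (\<Sum>n<N. g n)"
    by (simp add: mean_length_def sum_r[symmetric] distrib_left sum.distrib
        flip: sum_distrib_right)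
  finally show ?thesis .
qed

lemma sums:
  assumes "g sums s"
  shows "f sums (mean_length + (1 - q) * s)"
proof -
  have "(\<lambda>n. if n < B then q else 0) sums (real B * q)"
    using sums_If_finite_set[of "{..<B}" "\<lambda>_. q"] by simp
  then have "(\<lambda>n. (\<Sum>y<B. r y * g (n - (2 * y + 1))) + (if n < B then q else 0)) sums
      ((\<Sum>y<B. r y * (real (2 * y + 1) + s)) + real B * q)"
    by (intro sums_add sums_sum sums_mult sums_shift assms g_0)
  moreover have "(\<Sum>y<B. r y * (real (2 * y + 1) + s)) + real B * q = mean_length + (1 - q) * s"
    by (simp add: mean_length_def sum_r[symmetric] distrib_left sum.distrib
        flip: sum_distrib_right)
  ultimately show ?thesis
    unfolding renewal[symmetric] by simp
qed

text \<open>Subtract \<open>2 * m + 1\<close> times the total mass 1. Heights below \<open>m\<close>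
  have no mass and height \<open>m\<close> cancels. Each of the other heights, fewer than
  \<open>B\<close>, contributes at most \<open>2 * B * \<delta>\<close>, and the exit at most
  \<open>B * \<delta>\<close>.\<close>

lemma mean_length_estimate:
  assumes "\<And>y. y < m \<Longrightarrow> r y = 0" and "\<And>y. m < y \<Longrightarrow> y < B \<Longrightarrow> r y \<le> \<delta>" and "q \<le> \<delta>" and "m < B"
  shows "\<bar>mean_length - (2 * real m + 1)\<bar> \<le> (2 * real B * real B + real B) * \<delta>"
proof -
  have \<delta>: "0 \<le> \<delta>"
    using q_nonneg assms(3) by linarith
  have "mean_length - (2 * real m + 1)
      = mean_length - (2 * real m + 1) * ((\<Sum>y<B. r y) + q)"
    by (simp add: sum_r)
  also have "\<dots> = (\<Sum>y<B. r y * (2 * real y - 2 * real m)) + (real B - (2 * real m + 1)) * q"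
    by (simp add: mean_length_def sum_distrib_left sum_distrib_right sum_subtractf sum.distrib
        algebra_simps)
  finally have "\<bar>mean_length - (2 * real m + 1)\<bar>
      \<le> \<bar>\<Sum>y<B. r y * (2 * real y - 2 * real m)\<bar> + \<bar>(real B - (2 * real m + 1)) * q\<bar>"
    by linarith
  also have "\<bar>\<Sum>y<B. r y * (2 * real y - 2 * real m)\<bar> \<le> (\<Sum>y<B. 2 * real B * \<delta>)"
  proof (intro order_trans[OF sum_abs] sum_mono)
    fix y assume y: "y \<in> {..<B}"
    consider "y < m" | "y = m" | "m < y" by linarith
    then show "\<bar>r y * (2 * real y - 2 * real m)\<bar> \<le> 2 * real B * \<delta>"
    proof cases
      case 3
      then have "\<bar>r y * (2 * real y - 2 * real m)\<bar> = (2 * real y - 2 * real m) * r y"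
        using r_nonneg[of y] y by (simp add: abs_mult)
      also have "\<dots> \<le> 2 * real B * \<delta>"
        using 3 y r_nonneg[of y] assms(2)[of y] by (intro mult_mono) auto
      finally show ?thesis .
    qed (use assms(1)[of y] \<delta> in simp_all)
  qed
  also have "\<bar>(real B - (2 * real m + 1)) * q\<bar> \<le> real B * \<delta>"
    unfolding abs_mult using assms q_nonneg by (intro mult_mono) auto
  finally show ?thesis
    by (simp add: algebra_simps)
qed

lemma mean_length_nonneg: "0 \<le> mean_length"
  unfolding mean_length_def using r_nonneg q_nonneg by (intro add_nonneg_nonneg sum_nonneg) auto

end

subsection \<open>Convergence to the exponential law\<close>

text \<open>The hypothesis on \<open>p i * E i\<close> says that the lower bound, spread over blocks
  of length \<open>C\<close>, has asymptotically the sum \<open>E i\<close>. The missing upper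
  estimate on \<open>H\<close> comes from averaging over a time window of length proportional to
  \<open>E i\<close>.\<close>

lemma exponential_limit:
  fixes H :: "'i \<Rightarrow> nat \<Rightarrow> real" and p E :: "'i \<Rightarrow> real" and C :: nat
  assumes C: "0 < C"
    and p: "\<forall>\<^sub>F i in F. 0 < p i \<and> p i < 1"
    and H: "\<forall>\<^sub>F i in F. antimono (H i) \<and> H i 0 = 1 \<and> H i sums E i"
    and lower: "\<forall>\<^sub>F i in F. \<forall>k. (1 - p i) ^ k \<le> H i (C * k)"
    and p0: "(p \<longlongrightarrow> 0) F" and pE: "((\<lambda>i. p i * E i) \<longlongrightarrow> real C) F"
    and t: "0 \<le> t"
  shows "((\<lambda>i. H i (nat \<lfloor>t * E i\<rfloor>)) \<longlongrightarrow> exp (- t)) F"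
proof -
  \<comment> \<open>The lower bound extended to all times: inside a block \<open>H\<close> is
    compared with its value at the end of the block, hence the \<open>Suc\<close>.\<close>
  define lo where "lo i n = (1 - p i) ^ Suc (n div C)" for i n
  \<comment> \<open>Time \<open>s * E i\<close> is about \<open>s * C / p i\<close>, and rounding
    down costs at most \<open>p i\<close> after multiplication by \<open>p i\<close>.\<close>
  have pfloor: "((\<lambda>i. p i * real (nat \<lfloor>s * E i\<rfloor>)) \<longlongrightarrow> s * C) F" if "0 \<le> s" for s
  proof (rule tendsto_sandwich)
    have E_nonneg: "\<forall>\<^sub>F i in F. 0 \<le> p i \<and> 0 \<le> E i"
    proof -
      have "\<forall>\<^sub>F i in F. 0 < p i * E i"
        using order_tendstoD(1)[OF pE, of 0] C by simp
      with p show ?thesis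
        by eventually_elim (auto simp: zero_less_mult_iff)
    qed
    show "\<forall>\<^sub>F i in F. s * (p i * E i) - p i \<le> p i * real (nat \<lfloor>s * E i\<rfloor>)"
      using E_nonneg
    proof eventually_elim
      case (elim i)
      then have "p i * (s * E i - 1) \<le> p i * real (nat \<lfloor>s * E i\<rfloor>)"
        using that by (intro mult_left_mono) linarith+
      then show ?case by (simp add: algebra_simps)
    qed
    show "\<forall>\<^sub>F i in F. p i * real (nat \<lfloor>s * E i\<rfloor>) \<le> s * (p i * E i)"
      using E_nonneg
    proof eventually_elim
      case (elim i)
      have "0 \<le> s * E i" using elim that by simp
      then have "p i * real (nat \<lfloor>s * E i\<rfloor>) \<le> p i * (s * E i)"
        using elim by (intro mult_left_mono) auto
      then show ?case by (simp add: algebra_simps)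
    qed
    show "((\<lambda>i. s * (p i * E i) - p i) \<longlongrightarrow> s * C) F"
      using tendsto_diff[OF tendsto_mult_left[OF pE, of s] p0] by simp
    show "((\<lambda>i. s * (p i * E i)) \<longlongrightarrow> s * C) F"
      by (rule tendsto_mult_left[OF pE])
  qed
  have lo_lim: "((\<lambda>i. lo i (nat \<lfloor>s * E i\<rfloor>)) \<longlongrightarrow> exp (- s)) F" if "0 \<le> s" for s
  proof -
    define k where "k i = Suc (nat \<lfloor>s * E i\<rfloor> div C)" for i
    have k_bounds: "real (nat \<lfloor>s * E i\<rfloor>) / C \<le> real (k i)"
        "real (k i) \<le> real (nat \<lfloor>s * E i\<rfloor>) / C + 1" for i
    proof -
      have "nat \<lfloor>s * E i\<rfloor> \<le> C * k i"
        unfolding k_def using C by (metis dividend_less_times_div mult_Suc_right less_imp_le)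
      then have "real (nat \<lfloor>s * E i\<rfloor>) \<le> real C * real (k i)"
        by (metis of_nat_le_iff of_nat_mult)
      then show "real (nat \<lfloor>s * E i\<rfloor>) / C \<le> real (k i)"
        using C by (simp add: field_simps)
      show "real (k i) \<le> real (nat \<lfloor>s * E i\<rfloor>) / C + 1"
        unfolding k_def using of_nat_div_le_of_nat[where ?'a = real, of "nat \<lfloor>s * E i\<rfloor>" C] by simp
    qed
    have pk: "((\<lambda>i. p i * real (k i)) \<longlongrightarrow> s) F"
    proof (rule tendsto_sandwich)
      have "((\<lambda>i. p i * real (nat \<lfloor>s * E i\<rfloor>) / C) \<longlongrightarrow> s * C / C) F"
        using C by (intro tendsto_divide pfloor that) auto
      then show *: "((\<lambda>i. p i * real (nat \<lfloor>s * E i\<rfloor>) / C) \<longlongrightarrow> s) F"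
        using C by simp
      show "((\<lambda>i. p i * real (nat \<lfloor>s * E i\<rfloor>) / C + p i) \<longlongrightarrow> s) F"
        using tendsto_add[OF * p0] by simp
      show "\<forall>\<^sub>F i in F. p i * real (nat \<lfloor>s * E i\<rfloor>) / C \<le> p i * real (k i)"
        using p
      proof eventually_elim
        case (elim i)
        then show ?case
          using mult_left_mono[OF k_bounds(1)[of i], of "p i"] by simp
      qed
      show "\<forall>\<^sub>F i in F. p i * real (k i) \<le> p i * real (nat \<lfloor>s * E i\<rfloor>) / C + p i"
        using p
      proof eventually_elim
        case (elim i)
        then show ?case
          using mult_left_mono[OF k_bounds(2)[of i], of "p i"] by (simp add: distrib_left)
      qed
    qed
    \<comment> \<open>\<open>(1 - p) ^ k\<close> is the exponential of \<open>p * k\<close> times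
      this ratio.\<close>
    have ln_lim: "((\<lambda>i. ln (1 - p i) / p i) \<longlongrightarrow> - 1) F"
    proof (rule filterlim_compose[of "\<lambda>x::real. ln (1 - x) / x"])
      show "((\<lambda>x::real. ln (1 - x) / x) \<longlongrightarrow> - 1) (at_right 0)"
        by real_asymp
      show "filterlim p (at_right 0) F"
        using p0 p unfolding filterlim_at by (auto elim: eventually_mono)
    qed
    have "((\<lambda>i. exp (p i * real (k i) * (ln (1 - p i) / p i))) \<longlongrightarrow> exp (s * - 1)) F"
      by (intro tendsto_exp tendsto_mult pk ln_lim)
    moreover have "\<forall>\<^sub>F i in F. exp (p i * real (k i) * (ln (1 - p i) / p i)) = lo i (nat \<lfloor>s * E i\<rfloor>)"
      using p
    proof eventually_elim
      case (elim i)
      then show ?case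
        using exp_of_nat_mult[of "k i" "ln (1 - p i)"]
        by (simp add: lo_def k_def[symmetric])
    qed
    ultimately show ?thesis
      using Lim_transform_eventually by fastforce
  qed
  have lo_le: "\<forall>\<^sub>F i in F. \<forall>n. lo i n \<le> H i n"
    using H lower
  proof eventually_elim
    case (elim i)
    show ?case
    proof
      fix n
      have "n \<le> C * Suc (n div C)"
        using C by (metis dividend_less_times_div mult_Suc_right less_imp_le)
      then have "H i (C * Suc (n div C)) \<le> H i n"
        using elim by (auto dest: antimonoD)
      then show "lo i n \<le> H i n"
        unfolding lo_def using elim order_trans by blast
    qed
  qed
  txt \<open>The lower bound has almost the same sum as \<open>H\<close>, so by monotonicity \<open>H\<close> cannot exceed
    it by much at a given time.\<close>
  have upper: "\<forall>\<^sub>F i in F. \<forall>n K. real K * (H i (n + K) - lo i n) \<le> E i - C * (1 - p i) / p i"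
    using p H lo_le
  proof eventually_elim
    case (elim i)
    have "summable (lo i)"
      by (rule summable_comparison_test'[OF sums_summable, of "H i" "E i" 0])
         (use elim in \<open>auto simp: lo_def\<close>)
    then obtain s where s: "lo i sums s" by blast
    \<comment> \<open>\<open>lo i\<close> is constant on blocks of length \<open>C\<close>, so
      grouping turns its sum into a geometric series.\<close>
    have "(\<lambda>k. \<Sum>n\<in>{k * C..<k * C + C}. lo i n) sums s"
      by (rule sums_group[OF s C])
    moreover have "(\<Sum>n\<in>{k * C..<k * C + C}. lo i n) = C * (1 - p i) * (1 - p i) ^ k" for k
    proof -
      have "(\<Sum>n\<in>{k * C..<k * C + C}. lo i n) = (\<Sum>n\<in>{k * C..<k * C + C}. (1 - p i) ^ Suc k)"
      proof (intro sum.cong refl)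
        fix n assume "n \<in> {k * C..<k * C + C}"
        then have "n div C = k"
          by (intro div_nat_eqI) (auto simp: algebra_simps)
        then show "lo i n = (1 - p i) ^ Suc k"
          by (simp add: lo_def)
      qed
      then show ?thesis by simp
    qed
    moreover have "(\<lambda>k. C * (1 - p i) * (1 - p i) ^ k) sums (C * (1 - p i) * (1 / (1 - (1 - p i))))"
      using elim by (intro sums_mult geometric_sums) auto
    ultimately have s_eq: "s = C * (1 - p i) / p i"
      using sums_unique2 by fastforce
    have diff: "(\<lambda>n. H i n - lo i n) sums (E i - C * (1 - p i) / p i)"
      unfolding s_eq[symmetric] using elim s by (intro sums_diff) auto
    show ?case
    proof (intro allI)
      fix n K
      have "real K * (H i (n + K) - lo i n) = (\<Sum>m\<in>{n..<n+K}. H i (n + K) - lo i n)"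
        by simp
      \<comment> \<open>Both functions decrease, so on the window \<open>H\<close> is bounded below
        by its value at the right end and \<open>lo\<close> above by its value at the left
        end.\<close>
      also have "\<dots> \<le> (\<Sum>m\<in>{n..<n+K}. H i m - lo i m)"
      proof (intro sum_mono diff_mono)
        fix m assume m: "m \<in> {n..<n+K}"
        then show "H i (n + K) \<le> H i m"
          using elim antimonoD[of "H i" m "n + K"] by auto
        show "lo i m \<le> lo i n"
          unfolding lo_def using elim m by (intro power_decreasing) (auto intro: div_le_mono)
      qed
      also have "\<dots> \<le> E i - C * (1 - p i) / p i"
        using diff elim sums_unique[OF diff] by (auto simp: sums_summable intro!: sum_le_suminf)
      finally show "real K * (H i (n + K) - lo i n) \<le> E i - C * (1 - p i) / p i" .
    qed
  qed
  show ?thesis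
  proof (rule order_tendstoI)
    fix y assume "y < exp (- t)"
    then have "\<forall>\<^sub>F i in F. y < lo i (nat \<lfloor>t * E i\<rfloor>)"
      using lo_lim[OF t] order_tendstoD(1) by blast
    with lo_le show "\<forall>\<^sub>F i in F. y < H i (nat \<lfloor>t * E i\<rfloor>)"
      by eventually_elim (use less_le_trans in blast)
  next
    fix y assume y: "exp (- t) < y"
    show "\<forall>\<^sub>F i in F. H i (nat \<lfloor>t * E i\<rfloor>) < y"
    proof (cases "t = 0")
      case True
      then show ?thesis
        using H y by (auto elim: eventually_mono)
    next
      case False
      \<comment> \<open>The window reaches from \<open>(t - d) * E i\<close> to
        \<open>t * E i\<close>. It bounds \<open>H\<close> at the right end by \<open>lo\<close> at
        the left end, and \<open>d\<close> is taken small enough for the loss \<open>exp d\<close>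
        to keep the limit below \<open>y\<close>. At \<open>t = 0\<close> there is no room for a
        window, hence the separate case.\<close>
      have "((\<lambda>d. exp (- (t - d))) \<longlongrightarrow> exp (- (t - 0))) (at_right 0)"
        by (intro tendsto_intros)
      then have "\<forall>\<^sub>F d in at_right 0. exp (- (t - d)) < y"
        using y order_tendstoD(2) by force
      moreover have "\<forall>\<^sub>F d in at_right 0. 0 < d \<and> d < t"
        using False t by (intro eventually_at_rightI[of 0 t]) auto
      ultimately have "\<forall>\<^sub>F d in at_right (0::real). exp (- (t - d)) < y \<and> 0 < d \<and> d < t"
        by eventually_elim auto
      then obtain d where d: "exp (- (t - d)) < y" "0 < d" "d < t"
        using eventually_happens'[of "at_right (0::real)"] by auto
      have K: "((\<lambda>i. p i * real (nat \<lfloor>d * E i\<rfloor>)) \<longlongrightarrow> d * C) F"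
        using d by (intro pfloor) simp
      \<comment> \<open>Multiplied by \<open>p i\<close>, the gap between the two sums tends to 0,
        while the window length tends to \<open>d * C > 0\<close>.\<close>
      have "((\<lambda>i. p i * E i - C * (1 - p i)) \<longlongrightarrow> real C - real C * (1 - 0)) F"
        by (intro tendsto_diff pE tendsto_mult_left tendsto_const p0)
      then have "((\<lambda>i. lo i (nat \<lfloor>(t - d) * E i\<rfloor>)
          + (p i * E i - C * (1 - p i)) / (p i * real (nat \<lfloor>d * E i\<rfloor>)))
          \<longlongrightarrow> exp (- (t - d)) + (C - C * (1 - 0)) / (d * C)) F"
        using d C by (intro tendsto_add lo_lim tendsto_divide K) auto
      then have "\<forall>\<^sub>F i in F. lo i (nat \<lfloor>(t - d) * E i\<rfloor>)
          + (p i * E i - C * (1 - p i)) / (p i * real (nat \<lfloor>d * E i\<rfloor>)) < y"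
        using d order_tendstoD(2) by force
      moreover have "\<forall>\<^sub>F i in F. 0 < p i * real (nat \<lfloor>d * E i\<rfloor>)"
        using order_tendstoD(1)[OF K, of 0] d C by simp
      moreover have "\<forall>\<^sub>F i in F. 0 < p i * E i"
        using order_tendstoD(1)[OF pE, of 0] C by simp
      ultimately show ?thesis
        using upper p H
      proof eventually_elim
        case (elim i)
        let ?n = "nat \<lfloor>(t - d) * E i\<rfloor>" and ?K = "nat \<lfloor>d * E i\<rfloor>"
        have "0 \<le> E i" using elim by (auto simp: zero_less_mult_iff)
        then have "real_of_int \<lfloor>(t - d) * E i\<rfloor> + real_of_int \<lfloor>d * E i\<rfloor> \<le> t * E i"
          using add_mono[OF of_int_floor_le[of "(t - d) * E i"] of_int_floor_le[of "d * E i"]]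
          by (simp only: distrib_right[symmetric]) simp
        then have "\<lfloor>(t - d) * E i\<rfloor> + \<lfloor>d * E i\<rfloor> \<le> \<lfloor>t * E i\<rfloor>"
          by (simp add: le_floor_iff)
        moreover have "0 \<le> \<lfloor>(t - d) * E i\<rfloor>" "0 \<le> \<lfloor>d * E i\<rfloor>"
          using \<open>0 \<le> E i\<close> d by auto
        ultimately have "?n + ?K \<le> nat \<lfloor>t * E i\<rfloor>"
          by linarith
        then have "H i (nat \<lfloor>t * E i\<rfloor>) \<le> H i (?n + ?K)"
          using elim antimonoD[of "H i" "?n + ?K" "nat \<lfloor>t * E i\<rfloor>"] by auto
        moreover have "H i (?n + ?K) - lo i ?n \<le> (E i - C * (1 - p i) / p i) / ?K"
        proof -
          have "0 < real ?K" using elim by (simp add: zero_less_mult_iff)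
          moreover have "real ?K * (H i (?n + ?K) - lo i ?n) \<le> E i - C * (1 - p i) / p i"
            using elim by blast
          ultimately show ?thesis
            by (simp only: pos_le_divide_eq mult.commute)
        qed
        moreover have "(E i - C * (1 - p i) / p i) / ?K
            = (p i * E i - C * (1 - p i)) / (p i * real ?K)"
          using elim by (simp add: field_simps)
        ultimately show ?case
          using elim by linarith
      qed
    qed
  qed
qed

subsection \<open>Survival and exit side of the Zig-Zag walk\<close>

definition survival :: "(int \<Rightarrow> real) \<Rightarrow> int \<Rightarrow> int \<Rightarrow> nat \<Rightarrow> int \<times> int \<Rightarrow> real" where
  "survival W a b n z = measure_pmf.prob (path_pmf (zigzag_kernel W) n z)
     {zs. \<forall>z\<in>set zs. fst z \<in> {a<..<b}}"

text \<open>Exit at \<open>a\<close> within \<open>n\<close> steps rather than at time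
  \<open>n\<close>, so that the value increases with \<open>n\<close> to the probability of ever
  exiting at \<open>a\<close>.\<close>

definition exit_low :: "(int \<Rightarrow> real) \<Rightarrow> int \<Rightarrow> int \<Rightarrow> nat \<Rightarrow> int \<times> int \<Rightarrow> real" where
  "exit_low W a b n z = measure_pmf.prob (path_pmf (zigzag_kernel W) n z)
     {zs. \<exists>k<length zs. fst (zs ! k) = a \<and> (\<forall>i<k. fst (zs ! i) \<in> {a<..<b})}"

lemma prob_bind_bernoulli_pmf:
  assumes "0 \<le> q" "q \<le> 1"
  shows "measure_pmf.prob (bind_pmf (bernoulli_pmf q) g) A
      = q * measure_pmf.prob (g True) A + (1 - q) * measure_pmf.prob (g False) A"
proof -
  \<comment> \<open>Mapping to membership makes the probability a point mass, to which
    \<open>pmf_bind\<close> applies.\<close>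
  have prob: "measure_pmf.prob p A = pmf (map_pmf (\<lambda>x. x \<in> A) p) True" for p
    by (simp add: pmf.rep_eq vimage_def)
  show ?thesis
    using assms by (simp add: prob map_bind_pmf pmf_bind)
qed

lemma prob_path_zigzag_Suc:
  fixes W :: "int \<Rightarrow> real" and x v :: int
  defines "q \<equiv> min (exp (W x - W (x + v))) 1"
  shows "measure_pmf.prob (path_pmf (zigzag_kernel W) (Suc n) (x, v)) A
      = q * measure_pmf.prob (path_pmf (zigzag_kernel W) n (x + v, v)) {zs. (x, v) # zs \<in> A}
      + (1 - q) * measure_pmf.prob (path_pmf (zigzag_kernel W) n (x, - v)) {zs. (x, v) # zs \<in> A}"
proof -
  have q: "0 \<le> q" "q \<le> 1"
    by (auto simp: q_def)
  have "path_pmf (zigzag_kernel W) (Suc n) (x, v)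
      = bind_pmf (bernoulli_pmf q) (\<lambda>move. map_pmf ((#) (x, v))
          (path_pmf (zigzag_kernel W) n (if move then (x + v, v) else (x, - v))))"
    by (simp add: zigzag_kernel_def bind_map_pmf q_def)
  then show ?thesis
    by (simp only: prob_bind_bernoulli_pmf[OF q]) (simp add: vimage_def)
qed

lemma survival_0: "survival W a b 0 z = (if fst z \<in> {a<..<b} then 1 else 0)"
  by (simp add: survival_def)

lemma survival_outside: "fst z \<notin> {a<..<b} \<Longrightarrow> survival W a b n z = 0"
proof (cases n)
  case (Suc m)
  assume "fst z \<notin> {a<..<b}"
  then show ?thesis
    using prob_path_zigzag_Suc[of W m "fst z" "snd z"]
    by (cases "a < fst z") (simp_all add: Suc survival_def del: path_pmf.simps)
qed (simp add: survival_0)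

lemma survival_Suc:
  assumes "x \<in> {a<..<b}"
  shows "survival W a b (Suc n) (x, v)
      = min (exp (W x - W (x + v))) 1 * survival W a b n (x + v, v)
      + (1 - min (exp (W x - W (x + v))) 1) * survival W a b n (x, - v)"
  using assms by (simp add: survival_def prob_path_zigzag_Suc del: path_pmf.simps)

lemma survival_nonneg: "0 \<le> survival W a b n z"
  by (simp add: survival_def)

text \<open>Path laws of different lengths live on different lists, so there is no inclusion of
  events to use; the one-step recursion passes the inequality from \<open>n\<close> to
  \<open>Suc n\<close> for all starting states at once.\<close>

lemma antimono_survival: "antimono (\<lambda>n. survival W a b n z)"
proof (rule decseq_SucI)
  show "survival W a b (Suc n) z \<le> survival W a b n z" for n
  proof (induction n arbitrary: z)
    case 0
    have "survival W a b (Suc 0) z \<le> 1"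
      by (simp add: survival_def)
    then show ?case
      using survival_outside[of z a b W "Suc 0"] by (simp add: survival_0)
  next
    case (Suc n)
    obtain x v where z: "z = (x, v)" by (cases z)
    show ?case
    proof (cases "x \<in> {a<..<b}")
      case True
      show ?thesis
        unfolding z survival_Suc[OF True, of W "Suc n" v] survival_Suc[OF True, of W n v]
        by (intro add_mono mult_left_mono Suc) auto
    next
      case False
      then show ?thesis
        using survival_outside[of z a b W] z by simp
    qed
  qed
qed

lemma exit_low_0: "exit_low W a b 0 z = (if fst z = a then 1 else 0)"
  by (simp add: exit_low_def)

lemma exit_low_Suc:
  assumes "x \<in> {a<..<b}"
  shows "exit_low W a b (Suc n) (x, v)
      = min (exp (W x - W (x + v))) 1 * exit_low W a b n (x + v, v)
      + (1 - min (exp (W x - W (x + v))) 1) * exit_low W a b n (x, - v)"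
  using assms
  by (simp add: exit_low_def prob_path_zigzag_Suc Ex_less_Suc2 All_less_Suc2 del: path_pmf.simps)

lemma exit_low_outside:
  assumes "x \<notin> {a<..<b}"
  shows "exit_low W a b n (x, v) = (if x = a then 1 else 0)"
proof (cases n)
  case (Suc m)
  then show ?thesis
    using assms
    by (cases "a < x") (simp_all add: exit_low_def prob_path_zigzag_Suc Ex_less_Suc2 All_less_Suc2
        del: path_pmf.simps)
qed (simp add: exit_low_0)

lemma exit_low_le_1: "exit_low W a b n z \<le> 1"
  by (simp add: exit_low_def)

lemma incseq_exit_low: "incseq (\<lambda>n. exit_low W a b n z)"
proof (rule incseq_SucI)
  show "exit_low W a b n z \<le> exit_low W a b (Suc n) z" for n
  proof (induction n arbitrary: z)
    case 0
    show ?case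
      using exit_low_outside[of a a b W "Suc 0" "snd z"]
      by (cases z) (auto simp: exit_low_0, simp add: exit_low_def)
  next
    case (Suc n)
    obtain x v where z: "z = (x, v)" by (cases z)
    show ?case
    proof (cases "x \<in> {a<..<b}")
      case True
      show ?thesis
        unfolding z exit_low_Suc[OF True, of W "Suc n" v] exit_low_Suc[OF True, of W n v]
        by (intro add_mono mult_left_mono Suc) auto
    next
      case False
      then show ?thesis
        using z by (simp add: exit_low_outside)
    qed
  qed
qed

lemma exit_low_limit:
  obtains u where "\<And>z. (\<lambda>n. exit_low W a b n z) \<longlonglongrightarrow> u z"
proof -
  have "\<exists>L. (\<lambda>n. exit_low W a b n z) \<longlonglongrightarrow> L" for z
    using incseq_convergent[OF incseq_exit_low, of W a b z 1] exit_low_le_1 by metis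
  then show ?thesis
    using that by metis
qed

section \<open>Exit time and exit side of a trajectory\<close>

lemma less_exit_time_iff: "enat n < exit_time a b x \<longleftrightarrow> (\<forall>i\<le>n. x i \<in> {a<..<b})"
proof -
  have "enat n < exit_time a b x \<longleftrightarrow> enat (Suc n) \<le> exit_time a b x"
    by (metis Suc_ile_eq)
  also have "\<dots> \<longleftrightarrow> (\<forall>i. x i \<le> a \<or> b \<le> x i \<longrightarrow> Suc n \<le> i)"
    by (simp add: exit_time_def le_Inf_iff)
  finally show ?thesis
    by (meson greaterThanLessThan_iff linorder_not_le not_less_eq_eq)
qed

text \<open>Since \<open>a\<close> itself is outside, the \<open>k\<close> on the right is the exit
  time. The right-hand side is a union of events on finite paths.\<close>

lemma exit_time_low_iff:
  "exit_time a b x \<noteq> \<infinity> \<and> x (the_enat (exit_time a b x)) = a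
    \<longleftrightarrow> (\<exists>k. x k = a \<and> (\<forall>i<k. x i \<in> {a<..<b}))"
proof
  assume *: "exit_time a b x \<noteq> \<infinity> \<and> x (the_enat (exit_time a b x)) = a"
  then obtain k where k: "exit_time a b x = enat k" by auto
  have "x i \<in> {a<..<b}" if "i < k" for i
    using less_exit_time_iff[of i a b x] that k by auto
  then show "\<exists>k. x k = a \<and> (\<forall>i<k. x i \<in> {a<..<b})"
    using * k by auto
next
  assume "\<exists>k. x k = a \<and> (\<forall>i<k. x i \<in> {a<..<b})"
  then obtain k where k: "x k = a" "\<forall>i<k. x i \<in> {a<..<b}" by blast
  have "exit_time a b x \<le> enat k"
    using less_exit_time_iff[of k a b x] k by (auto simp: not_less[symmetric])
  moreover have "\<not> exit_time a b x < enat k"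
  proof
    assume "exit_time a b x < enat k"
    then obtain m where m: "exit_time a b x = enat m" "m < k"
      by (metis enat_iless enat_ord_simps(2))
    then show False
      using less_exit_time_iff[of m a b x] k by auto
  qed
  ultimately have "exit_time a b x = enat k" by simp
  then show "exit_time a b x \<noteq> \<infinity> \<and> x (the_enat (exit_time a b x)) = a"
    using k by simp
qed

context
  fixes M :: "'a measure" and W :: "int \<Rightarrow> real" and X V :: "nat \<Rightarrow> 'a \<Rightarrow> int"
  assumes walk: "zigzag_walk M W X V"
begin

lemma zigzag_prob_space: "prob_space M"
  using walk by (simp add: zigzag_walk_def markov_chain_def)

lemma zigzag_measurable: "X i \<in> measurable M (count_space UNIV)"
proof -
  have "(\<lambda>\<omega>. (X i \<omega>, V i \<omega>)) \<in> measurable M (count_space UNIV)"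
    by (rule markov_chain_measurable[OF walk[unfolded zigzag_walk_def]])
  from measurable_compose[OF this, of fst "count_space UNIV"] show ?thesis by simp
qed

lemma zigzag_inside_measurable: "Measurable.pred M (\<lambda>\<omega>. X i \<omega> \<in> A)"
  using measurable_compose[OF zigzag_measurable, of "\<lambda>x. x \<in> A" "count_space UNIV"] by simp

lemma exit_time_measurable:
  "(\<lambda>\<omega>. exit_time a b (\<lambda>n. X n \<omega>)) \<in> measurable M (count_space UNIV)"
proof (subst measurable_count_space_eq2_countable, safe)
  fix y
  let ?T = "\<lambda>\<omega>. exit_time a b (\<lambda>n. X n \<omega>)"
  note zigzag_inside_measurable[measurable]
  have [measurable]: "Measurable.pred M (\<lambda>\<omega>. enat k < ?T \<omega>)" for k
    unfolding less_exit_time_iff by measurable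
  show "?T -` {y} \<inter> space M \<in> sets M"
  proof (cases y)
    case (enat k)
    have "t = y \<longleftrightarrow> \<not> enat k < t \<and> (\<forall>j<k. enat j < t)" for t
      unfolding enat by (cases t) (auto simp: not_less_iff_gr_or_eq)
    then have "?T -` {y} \<inter> space M = {\<omega> \<in> space M. \<not> enat k < ?T \<omega> \<and> (\<forall>j<k. enat j < ?T \<omega>)}"
      by blast
    also have "\<dots> \<in> sets M"
      by measurable
    finally show ?thesis .
  next
    case infinity
    have "t = y \<longleftrightarrow> (\<forall>j. enat j < t)" for t
      unfolding infinity by (cases t) auto
    then have "?T -` {y} \<inter> space M = {\<omega> \<in> space M. \<forall>j. enat j < ?T \<omega>}"
      by blast
    also have "\<dots> \<in> sets M"
      by measurable
    finally show ?thesis .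
  qed
qed auto

context
  fixes x v :: int
  assumes init: "AE \<omega> in M. X 0 \<omega> = x \<and> V 0 \<omega> = v"
begin

lemma zigzag_path_prob:
  "\<P>(\<omega> in M. Q (map (\<lambda>i. (X i \<omega>, V i \<omega>)) [0..<Suc n]))
    = measure_pmf.prob (path_pmf (zigzag_kernel W) n (x, v)) {zs. Q zs}"
  by (rule markov_chain_path_prob[OF walk[unfolded zigzag_walk_def]]) (use init in simp)

lemma prob_less_exit_time:
  "\<P>(\<omega> in M. enat n < exit_time a b (\<lambda>n. X n \<omega>)) = survival W a b n (x, v)"
proof -
  have "(\<forall>z\<in>set (map f [0..<Suc n]). fst z \<in> {a<..<b}) \<longleftrightarrow> (\<forall>i\<le>n. fst (f i) \<in> {a<..<b})"
    for f :: "nat \<Rightarrow> int \<times> int"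
    by (auto simp: less_Suc_eq_le simp del: upt_Suc)
  then show ?thesis
    unfolding less_exit_time_iff survival_def
    by (subst zigzag_path_prob[symmetric]) (simp only: fst_conv)
qed

text \<open>Continuity from below: the events of having exited at \<open>a\<close> by time
  \<open>n\<close> increase to the event of exiting there.\<close>

lemma prob_exit_low:
  "(\<lambda>n. exit_low W a b n (x, v)) \<longlonglongrightarrow> \<P>(\<omega> in M. exit_time a b (\<lambda>n. X n \<omega>) \<noteq> \<infinity>
      \<and> X (the_enat (exit_time a b (\<lambda>n. X n \<omega>))) \<omega> = a)"
proof -
  interpret prob_space M by (rule zigzag_prob_space)
  note [measurable] = zigzag_measurable zigzag_inside_measurable
  let ?A = "\<lambda>n. {\<omega> \<in> space M. \<exists>k<Suc n. X k \<omega> = a \<and> (\<forall>i<k. X i \<omega> \<in> {a<..<b})}"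
  have low: "(\<exists>k<length (map f [0..<Suc n]). fst (map f [0..<Suc n] ! k) = a
        \<and> (\<forall>i<k. fst (map f [0..<Suc n] ! i) \<in> {a<..<b}))
      \<longleftrightarrow> (\<exists>k<Suc n. fst (f k) = a \<and> (\<forall>i<k. fst (f i) \<in> {a<..<b}))"
    for n and f :: "nat \<Rightarrow> int \<times> int"
  proof -
    have "length (map f [0..<Suc n]) = Suc n" "\<And>i. i < Suc n \<Longrightarrow> map f [0..<Suc n] ! i = f i"
      by (simp_all del: upt_Suc)
    moreover have "i < Suc n" if "i < k" "k < Suc n" for i k
      using that by simp
    ultimately show ?thesis
      by (simp only: cong: conj_cong imp_cong)
  qed
  have "exit_low W a b n (x, v) = prob (?A n)" for n
    unfolding exit_low_def by (subst zigzag_path_prob[symmetric]) (simp only: low fst_conv)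
  moreover have "(\<Union>n. ?A n) = {\<omega> \<in> space M. exit_time a b (\<lambda>n. X n \<omega>) \<noteq> \<infinity>
      \<and> X (the_enat (exit_time a b (\<lambda>n. X n \<omega>))) \<omega> = a}"
    using exit_time_low_iff[of a b "\<lambda>n. X n _"] by (auto intro: lessI)
  moreover have "(\<lambda>n. prob (?A n)) \<longlonglongrightarrow> prob (\<Union>n. ?A n)"
  proof (rule finite_Lim_measure_incseq)
    show "range ?A \<subseteq> sets M"
      by (rule image_subsetI) measurable
    show "incseq ?A"
    proof (rule incseq_SucI)
      show "?A n \<subseteq> ?A (Suc n)" for n
        using less_SucI by blast
    qed
  qed
  ultimately show ?thesis by simp
qed

end

end

section \<open>One-sided excursions of the walk\<close>

lemma convex_step_rescaled:
  fixes p q q' s t :: real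
  assumes "p = q' / q" "q \<noteq> 0"
  shows "q * (p * s + (1 - p) * t) = q' * s + (q - q') * t"
  using assms(2) by (simp add: assms(1) field_simps)

text \<open>The sign \<open>s\<close> treats both sides at once, with height \<open>y\<close> at
  position \<open>s * int y\<close>. By monotonicity an outward step is accepted with probability
  \<open>e (Suc y) / e y\<close> and an inward step always, which is the setting of
  \<open>excursion_renewal\<close>.\<close>

lemma survival_excursion:
  fixes W :: "int \<Rightarrow> real" and s a b :: int and B :: nat
  defines "e \<equiv> \<lambda>y::nat. exp (- W (s * int y))"
  assumes W0: "W 0 = 0" and mono: "mono (\<lambda>y::nat. W (s * int y))" and s: "s = 1 \<or> s = - 1"
    and inside: "\<And>y::nat. y < B \<Longrightarrow> s * int y \<in> {a<..<b}" and exit: "s * int B \<notin> {a<..<b}"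
  shows "survival W a b n (0, s) = (\<Sum>y<B. (e y - e (Suc y)) * survival W a b (n - (2 * y + 1)) (0, - s))
      + (if n < B then e B else 0)"
proof -
  have "e 0 * survival W a b n (s * int 0, s)
      = (\<Sum>y=0..<B. (e y - e (Suc y)) * survival W a b (n - (2 * y - 0 + 1)) (s * int 0, - s))
        + (if n < B - 0 then e B else 0)"
  proof (rule excursion_renewal[where R = "\<lambda>n x. survival W a b n (s * int x, s)"
        and L = "\<lambda>n x. survival W a b n (s * int x, - s)"])
    fix x n assume x: "x < B"
    have q: "min (exp (W (s * int x) - W (s * int (Suc x)))) 1 = e (Suc x) / e x"
      using monoD[OF mono, of x "Suc x"]
      by (simp add: e_def exp_diff[symmetric] min_def del: of_nat_Suc)
    have pos: "s * int x + s = s * int (Suc x)"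
      by (simp add: distrib_left)
    show "e x * survival W a b (Suc n) (s * int x, s)
        = e (Suc x) * survival W a b n (s * int (Suc x), s)
          + (e x - e (Suc x)) * survival W a b n (s * int x, - s)"
      unfolding survival_Suc[OF inside[OF x]] pos
      by (rule convex_step_rescaled[OF q]) (simp add: e_def)
  next
    fix x n assume x: "Suc x < B"
    have "min (exp (W (s * int (Suc x)) - W (s * int (Suc x) + - s))) 1 = 1"
      using monoD[OF mono, of x "Suc x"] by (simp add: distrib_left min_def)
    then show "survival W a b (Suc n) (s * int (Suc x), - s) = survival W a b n (s * int x, - s)"
      using survival_Suc[OF inside[OF x], of W n "- s"] by (simp add: distrib_left)
  qed (use inside exit in \<open>auto simp: survival_0 survival_outside\<close>)
  then show ?thesis
    by (simp add: e_def W0 atLeast0LessThan)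
qed

text \<open>In the limit \<open>exit_low_Suc\<close> becomes a harmonic equation for
  \<open>u\<close>, so \<open>excursion_hitting\<close> takes the place of the renewal
  equation.\<close>

lemma exit_low_excursion:
  fixes W :: "int \<Rightarrow> real" and s a b :: int and B :: nat
  defines "e \<equiv> \<lambda>y::nat. exp (- W (s * int y))"
  assumes W0: "W 0 = 0" and mono: "mono (\<lambda>y::nat. W (s * int y))" and s: "s = 1 \<or> s = - 1"
    and inside: "\<And>y::nat. y < B \<Longrightarrow> s * int y \<in> {a<..<b}" and exit: "s * int B \<notin> {a<..<b}"
    and u: "\<And>z. (\<lambda>n. exit_low W a b n z) \<longlonglongrightarrow> u z"
  shows "u (0, s) = (1 - e B) * u (0, - s) + e B * (if s * int B = a then 1 else 0)"
proof -
  have u_Suc: "u (x, v) = min (exp (W x - W (x + v))) 1 * u (x + v, v)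
      + (1 - min (exp (W x - W (x + v))) 1) * u (x, - v)" if "x \<in> {a<..<b}" for x v
  proof (rule LIMSEQ_unique)
    show "(\<lambda>n. exit_low W a b (Suc n) (x, v)) \<longlonglongrightarrow> u (x, v)"
      by (rule LIMSEQ_Suc[OF u])
    show "(\<lambda>n. exit_low W a b (Suc n) (x, v)) \<longlonglongrightarrow> min (exp (W x - W (x + v))) 1 * u (x + v, v)
      + (1 - min (exp (W x - W (x + v))) 1) * u (x, - v)"
      unfolding exit_low_Suc[OF that] by (intro tendsto_intros u)
  qed
  have u_exit: "u (s * int B, s) = (if s * int B = a then 1 else 0)"
    using u[of "(s * int B, s)"] unfolding exit_low_outside[OF exit]
    by (rule LIMSEQ_unique[OF _ tendsto_const])
  have "e 0 * u (s * int 0, s) = (e 0 - e B) * u (s * int 0, - s) + e B * u (s * int B, s)"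
  proof (rule excursion_hitting[where R = "\<lambda>x. u (s * int x, s)" and L = "\<lambda>x. u (s * int x, - s)"])
    fix x assume x: "x < B"
    have q: "min (exp (W (s * int x) - W (s * int (Suc x)))) 1 = e (Suc x) / e x"
      using monoD[OF mono, of x "Suc x"]
      by (simp add: e_def exp_diff[symmetric] min_def del: of_nat_Suc)
    have pos: "s * int x + s = s * int (Suc x)"
      by (simp add: distrib_left)
    show "e x * u (s * int x, s)
        = e (Suc x) * u (s * int (Suc x), s) + (e x - e (Suc x)) * u (s * int x, - s)"
      unfolding u_Suc[OF inside[OF x], of s] pos
      by (rule convex_step_rescaled[OF q]) (simp add: e_def)
  next
    fix x assume x: "Suc x < B"
    have "min (exp (W (s * int (Suc x)) - W (s * int (Suc x) + - s))) 1 = 1"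
      using monoD[OF mono, of x "Suc x"] by (simp add: distrib_left min_def)
    then show "u (s * int (Suc x), - s) = u (s * int x, - s)"
      using u_Suc[OF inside[OF x], of "- s"] by (simp add: distrib_left)
  qed simp
  then show ?thesis
    by (simp add: e_def W0 u_exit)
qed

section \<open>The potential well with its plateau\<close>

locale zigzag_well =
  fixes W :: "int \<Rightarrow> real" and a \<alpha> \<beta> b :: int
  assumes W_left: "antimono_on {..0} W" and W_right: "mono_on {0..} W"
    and order: "a < \<alpha>" "\<alpha> \<le> 0" "0 \<le> \<beta>" "\<beta> < b"
    and zeros: "{\<alpha>..\<beta>} = {k. W k = 0}"
begin

text \<open>The probability that a loop exits on either side; \<open>exit_factor\<close> shows the
  complement as the product of the two return probabilities.\<close>

definition exit_prob :: real where
  "exit_prob = exp (- W b) + exp (- W a) - exp (- (W b + W a))"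

abbreviation "h \<equiv> \<lambda>n. survival W a b n (0, 1)"
abbreviation "h' \<equiv> \<lambda>n. survival W a b n (0, - 1)"

definition plateau :: nat where "plateau = nat (\<beta> - \<alpha> + 1)"

lemma W_zero: "k \<in> {\<alpha>..\<beta>} \<Longrightarrow> W k = 0"
  using zeros by blast

lemma W0: "W 0 = 0"
  using order by (intro W_zero) auto

lemma W_nonneg: "0 \<le> W k"
proof (cases "0 \<le> k")
  case True
  then show ?thesis
    using monotone_onD[OF W_right, of 0 k] W0 by simp
next
  case False
  then show ?thesis
    using monotone_onD[OF W_left, of k 0] W0 by simp
qed

lemma W_pos: "k \<notin> {\<alpha>..\<beta>} \<Longrightarrow> 0 < W k"
  using W_nonneg[of k] zeros by (metis less_eq_real_def mem_Collect_eq)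

text \<open>The factor \<open>1\<close> keeps the form \<open>s * int y\<close> of the excursion
  lemmas.\<close>

lemma mono_right: "mono (\<lambda>y::nat. W (1 * int y))"
  by (auto intro!: monoI monotone_onD[OF W_right])

lemma mono_left: "mono (\<lambda>y::nat. W (- 1 * int y))"
  by (auto intro!: monoI monotone_onD[OF W_left, simplified])

lemma exit_factor: "1 - exit_prob = (1 - exp (- W b)) * (1 - exp (- W a))"
  by (simp add: exit_prob_def algebra_simps exp_add[symmetric] exp_minus_inverse)

lemma exp_W: "0 < exp (- W b)" "exp (- W b) < 1" "0 < exp (- W a)" "exp (- W a) < 1"
  using W_pos[of a] W_pos[of b] order by auto

lemma exit_prob_bounds: "0 < exit_prob" "exit_prob < 1"
proof -
  have "0 < 1 - exit_prob"
    unfolding exit_factor using exp_W by simp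
  then show "exit_prob < 1" by simp
  have "(1 - exp (- W b)) * (1 - exp (- W a)) < 1 * 1"
    using exp_W by (intro mult_strict_mono) auto
  then show "0 < exit_prob"
    using exit_factor by simp
qed

lemma h_0: "h 0 = 1" "h' 0 = 1"
  using order by (auto simp: survival_0)

text \<open>The two excursions feed each other: the right one expresses \<open>h\<close> by
  \<open>h'\<close>, the left one \<open>h'\<close> by \<open>h\<close>, so using both in turn
  closes the recursion.\<close>

sublocale right: excursion h h' "\<lambda>y. exp (- W (int y)) - exp (- W (int (Suc y)))" "exp (- W b)" "nat b"
proof
  show "h n = (\<Sum>y<nat b. (exp (- W (int y)) - exp (- W (int (Suc y)))) * h' (n - (2 * y + 1)))
      + (if n < nat b then exp (- W b) else 0)" for n
    using survival_excursion[OF W0 mono_right, of "nat b" a b n] order by simp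
  show "(\<Sum>y<nat b. exp (- W (int y)) - exp (- W (int (Suc y)))) = 1 - exp (- W b)"
    using sum_lessThan_telescope'[of "\<lambda>y. exp (- W (int y))" "nat b"] order W0 by simp
qed (use monoD[OF mono_right] h_0 in \<open>auto simp: survival_nonneg antimono_survival simp flip: of_nat_Suc\<close>)

sublocale left: excursion h' h "\<lambda>y. exp (- W (- int y)) - exp (- W (- int (Suc y)))" "exp (- W a)" "nat (- a)"
proof
  show "h' n = (\<Sum>y<nat (- a). (exp (- W (- int y)) - exp (- W (- int (Suc y)))) * h (n - (2 * y + 1)))
      + (if n < nat (- a) then exp (- W a) else 0)" for n
    using survival_excursion[OF W0 mono_left, of "nat (- a)" a b n] order by simp
  show "(\<Sum>y<nat (- a). exp (- W (- int y)) - exp (- W (- int (Suc y)))) = 1 - exp (- W a)"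
    using sum_lessThan_telescope'[of "\<lambda>y. exp (- W (- int y))" "nat (- a)"] order W0 by simp
qed (use monoD[OF mono_left] h_0 in \<open>auto simp: survival_nonneg antimono_survival simp flip: of_nat_Suc\<close>)

lemma right_flat: "y < nat \<beta> \<Longrightarrow> exp (- W (int y)) - exp (- W (int (Suc y))) = 0"
  using W_zero[of "int y"] W_zero[of "int (Suc y)"] order by simp

lemma left_flat: "y < nat (- \<alpha>) \<Longrightarrow> exp (- W (- int y)) - exp (- W (- int (Suc y))) = 0"
  using W_zero[of "- int y"] W_zero[of "- int (Suc y)"] order by simp

lemma survival_lower: "(1 - exit_prob) ^ k \<le> h (2 * plateau * k)"
proof (induction k)
  case (Suc k)
  let ?n = "2 * plateau * Suc k"
  \<comment> \<open>The shortest loop turns at the two ends of the plateau: \<open>(2 * nat \<beta>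
    + 1) + (2 * nat (- \<alpha>) + 1) = 2 * plateau\<close>.\<close>
  have n: "?n - (2 * nat \<beta> + 1) - (2 * nat (- \<alpha>) + 1) = 2 * plateau * k"
    using order by (simp add: plateau_def nat_add_distrib nat_diff_distrib)
  have "(1 - exit_prob) ^ Suc k \<le> (1 - exit_prob) * h (2 * plateau * k)"
    using Suc exit_prob_bounds by simp
  also have "\<dots> = (1 - exp (- W b)) * ((1 - exp (- W a)) * h (2 * plateau * k))"
    by (simp add: exit_factor)
  also have "\<dots> \<le> (1 - exp (- W b)) * h' (?n - (2 * nat \<beta> + 1))"
    using left.lower[OF left_flat, of "nat (- \<alpha>)" "?n - (2 * nat \<beta> + 1)"] exp_W n
    by (intro mult_left_mono) auto
  also have "\<dots> \<le> h ?n"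
    using right.lower[OF right_flat] by auto
  finally show ?case .
qed (simp add: h_0)

text \<open>A loop that does not exit turns at \<open>b - 1\<close> and \<open>a + 1\<close> at the
  furthest and lasts at most \<open>2 * (b - a) - 2\<close> steps. The block is four steps longer,
  which monotonicity of survival absorbs.\<close>

lemma survival_upper: "h (2 * nat (b - a + 1) * k) \<le> (1 - exit_prob) ^ k"
proof (induction k)
  case (Suc k)
  let ?d = "nat (b - a + 1)"
  let ?n = "2 * ?d * Suc k"
  have n: "nat b \<le> ?n" "nat (- a) \<le> ?n - (2 * nat b - 1)"
      "2 * ?d * k \<le> ?n - (2 * nat b - 1) - (2 * nat (- a) - 1)"
    using order by (simp_all add: nat_add_distrib nat_diff_distrib distrib_left)
  have "h ?n \<le> (1 - exp (- W b)) * h' (?n - (2 * nat b - 1))"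
    using n by (intro right.upper)
  also have "\<dots> \<le> (1 - exp (- W b)) * ((1 - exp (- W a)) * h (2 * ?d * k))"
  proof (intro mult_left_mono)
    have "h' (?n - (2 * nat b - 1))
        \<le> (1 - exp (- W a)) * h (?n - (2 * nat b - 1) - (2 * nat (- a) - 1))"
      using n by (intro left.upper)
    also have "\<dots> \<le> (1 - exp (- W a)) * h (2 * ?d * k)"
      using n exp_W by (intro mult_left_mono antimonoD[OF antimono_survival]) auto
    finally show "h' (?n - (2 * nat b - 1)) \<le> (1 - exp (- W a)) * h (2 * ?d * k)" .
  qed (use exp_W in auto)
  also have "\<dots> = (1 - exit_prob) * h (2 * ?d * k)"
    by (simp add: exit_factor)
  also have "\<dots> \<le> (1 - exit_prob) ^ Suc k"
    using Suc exit_prob_bounds by simp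
  finally show ?case .
qed (simp add: h_0)

text \<open>The mean duration of a loop stopped at the exit: the left excursion is made only if the
  right one returns.\<close>

definition loop_length :: real where
  "loop_length = right.mean_length + (1 - exp (- W b)) * left.mean_length"

text \<open>Both excursions together bound a partial sum by \<open>loop_length\<close> plus
  \<open>1 - exit_prob\<close> times itself. Being finite, it can be moved to the left.\<close>

lemma summable_survival: "summable h"
proof (rule summableI_nonneg_bounded)
  fix N
  have "(\<Sum>n<N. h n) \<le> right.mean_length + (1 - exp (- W b)) * (\<Sum>n<N. h' n)"
    by (rule right.partial_sum_le)
  also have "\<dots> \<le> right.mean_length
      + (1 - exp (- W b)) * (left.mean_length + (1 - exp (- W a)) * (\<Sum>n<N. h n))"
    using exp_W by (intro add_left_mono mult_left_mono left.partial_sum_le) auto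
  also have "\<dots> = loop_length + (1 - exit_prob) * (\<Sum>n<N. h n)"
    by (simp add: loop_length_def exit_factor algebra_simps)
  finally show "(\<Sum>n<N. h n) \<le> loop_length / exit_prob"
    using exit_prob_bounds by (simp add: pos_le_divide_eq algebra_simps)
qed (rule survival_nonneg)

text \<open>Now that the sum exists, the same substitution is an equation. The outcome has the form
  of Wald's identity: mean loop length times the mean number \<open>1 / exit_prob\<close> of
  loops.\<close>

lemma survival_sums: "h sums (loop_length / exit_prob)"
proof -
  obtain s where s: "h sums s"
    using summable_survival by blast
  have "h sums (right.mean_length + (1 - exp (- W b)) * (left.mean_length + (1 - exp (- W a)) * s))"
    by (intro right.sums left.sums s)
  note sums_unique2[OF s this]
  also have "right.mean_length + (1 - exp (- W b)) * (left.mean_length + (1 - exp (- W a)) * s)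
      = loop_length + (1 - exit_prob) * s"
    by (simp add: loop_length_def exit_factor algebra_simps)
  finally have "s * exit_prob = loop_length"
    by (simp add: algebra_simps)
  then have "s = loop_length / exit_prob"
    using exit_prob_bounds by (simp add: eq_divide_eq)
  then show ?thesis using s by simp
qed

text \<open>The first two constants are those of \<open>mean_length_estimate\<close> on each side.
  The last one bounds the left mean length by means of \<open>\<delta> \<le> 1\<close>; it is
  multiplied by \<open>exp (- W b)\<close>, itself at most \<open>\<delta>\<close>.\<close>

lemma loop_length_estimate:
  fixes \<delta> :: real
  defines "C \<equiv> \<lambda>B::nat. 2 * real B * real B + real B"
  assumes \<delta>: "exp (- W (\<beta> + 1)) \<le> \<delta>" "exp (- W (\<alpha> - 1)) \<le> \<delta>" "\<delta> \<le> 1"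
  shows "\<bar>loop_length - 2 * real plateau\<bar>
      \<le> (C (nat b) + C (nat (- a)) + (2 * real (nat (- \<alpha>)) + 1 + C (nat (- a)))) * \<delta>"
proof -
  have C: "0 \<le> C B" for B by (simp add: C_def)
  have \<delta>0: "0 \<le> \<delta>"
    using \<delta>(1) by (meson exp_ge_zero order_trans)
  have right: "exp (- W k) \<le> \<delta>" if "\<beta> < k" for k
  proof -
    have "W (\<beta> + 1) \<le> W k"
      using that order by (intro monotone_onD[OF W_right]) auto
    then show ?thesis using \<delta> by (meson exp_le_cancel_iff neg_le_iff_le order_trans)
  qed
  have left: "exp (- W k) \<le> \<delta>" if "k < \<alpha>" for k
  proof -
    have "W (\<alpha> - 1) \<le> W k"
      using that order monotone_onD[OF W_left, of k "\<alpha> - 1"] by auto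
    then show ?thesis using \<delta> by (meson exp_le_cancel_iff neg_le_iff_le order_trans)
  qed
  have R: "\<bar>right.mean_length - (2 * real (nat \<beta>) + 1)\<bar> \<le> C (nat b) * \<delta>"
    unfolding C_def
  proof (rule right.mean_length_estimate[OF right_flat])
    fix y :: nat assume "nat \<beta> < y"
    then have "exp (- W (int y)) \<le> \<delta>" using order by (intro right) auto
    then show "exp (- W (int y)) - exp (- W (int (Suc y))) \<le> \<delta>"
      using exp_gt_zero[of "- W (int (Suc y))"] by linarith
  qed (use right order in auto)
  have L: "\<bar>left.mean_length - (2 * real (nat (- \<alpha>)) + 1)\<bar> \<le> C (nat (- a)) * \<delta>"
    unfolding C_def
  proof (rule left.mean_length_estimate[OF left_flat])
    fix y :: nat assume "nat (- \<alpha>) < y"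
    then have "exp (- W (- int y)) \<le> \<delta>" using order by (intro left) auto
    then show "exp (- W (- int y)) - exp (- W (- int (Suc y))) \<le> \<delta>"
      using exp_gt_zero[of "- W (- int (Suc y))"] by linarith
  qed (use left order in auto)
  have "left.mean_length \<le> 2 * real (nat (- \<alpha>)) + 1 + C (nat (- a))"
    using L mult_left_mono[OF \<delta>(3) C, of "nat (- a)"] by linarith
  then have "exp (- W b) * left.mean_length \<le> \<delta> * (2 * real (nat (- \<alpha>)) + 1 + C (nat (- a)))"
    using right[of b] order \<delta>0 left.mean_length_nonneg by (intro mult_mono) auto
  moreover have "0 \<le> exp (- W b) * left.mean_length"
    using left.mean_length_nonneg by simp
  moreover have "loop_length - 2 * real plateau = (right.mean_length - (2 * real (nat \<beta>) + 1))
      + (left.mean_length - (2 * real (nat (- \<alpha>)) + 1)) - exp (- W b) * left.mean_length"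
    using order by (simp add: loop_length_def plateau_def algebra_simps)
  ultimately show ?thesis
    using R L by (simp add: algebra_simps abs_le_iff) 
qed

text \<open>A right excursion can exit only at \<open>b\<close>, so \<open>a\<close> is reached on
  the left. Eliminating \<open>u (0, - 1)\<close> leaves a linear equation for
  \<open>u (0, 1)\<close> that is solvable as \<open>exit_prob\<close> is positive.\<close>

lemma exit_low_tendsto:
  "(\<lambda>n. exit_low W a b n (0, 1)) \<longlonglongrightarrow> (1 - exp (- W b)) * exp (- W a) / exit_prob"
proof -
  obtain u where u: "\<And>z. (\<lambda>n. exit_low W a b n z) \<longlonglongrightarrow> u z"
    using exit_low_limit[of W a b] by blast
  have "u (0, 1) = (1 - exp (- W b)) * u (0, - 1)"
    using exit_low_excursion[OF W0 mono_right _ _ _ u, of "nat b"] order by simp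
  moreover have "u (0, - 1) = (1 - exp (- W a)) * u (0, 1) + exp (- W a)"
    using exit_low_excursion[OF W0 mono_left _ _ _ u, of "nat (- a)"] order by simp
  ultimately have "u (0, 1) = (1 - exp (- W b)) * ((1 - exp (- W a)) * u (0, 1) + exp (- W a))"
    by simp
  then have "u (0, 1) = (1 - exit_prob) * u (0, 1) + (1 - exp (- W b)) * exp (- W a)"
    by (simp only: exit_factor distrib_left mult.assoc)
  then have "u (0, 1) = (1 - exp (- W b)) * exp (- W a) / exit_prob"
    using exit_prob_bounds by (simp add: field_simps)
  then show ?thesis
    using u[of "(0, 1)"] by simp
qed

end

subsection \<open>Laws of the exit time\<close>

lemma geometric_rv_cdf:
  assumes "geometric_rv N G p"
  shows "\<P>(\<omega> in N. G \<omega> \<le> k) = 1 - (1 - p) ^ k"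
proof -
  interpret prob_space N
    using assms by (simp add: geometric_rv_def)
  have G: "G \<in> measurable N (count_space {1..})"
    using assms by (simp add: geometric_rv_def)
  have G_ge: "1 \<le> G \<omega>" if "\<omega> \<in> space N" for \<omega>
    using measurable_space[OF G that] by simp
  have [measurable]: "G \<in> measurable N (count_space UNIV)"
    using measurable_compose[OF G, of "\<lambda>x. x" "count_space UNIV"] by simp
  show ?thesis
  proof (induction k)
    case 0
    have "{\<omega> \<in> space N. G \<omega> \<le> 0} = {}"
      using G_ge by fastforce
    then show ?case by (simp only:) simp
  next
    case (Suc k)
    have "{\<omega> \<in> space N. G \<omega> \<le> Suc k} = {\<omega> \<in> space N. G \<omega> \<le> k} \<union> {\<omega> \<in> space N. G \<omega> = Suc k}"
      by auto
    then have "\<P>(\<omega> in N. G \<omega> \<le> Suc k) = \<P>(\<omega> in N. G \<omega> \<le> k) + \<P>(\<omega> in N. G \<omega> = Suc k)"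
      by (simp only:) (rule finite_measure_Union, auto)
    moreover have "\<P>(\<omega> in N. G \<omega> = Suc k) = p * (1 - p) ^ k"
      using assms unfolding geometric_rv_def by (metis One_nat_def Suc_le_mono diff_Suc_1 zero_le)
    ultimately show ?case
      using Suc by (simp add: algebra_simps)
  qed
qed

lemma prob_enat_le:
  assumes "prob_space M" and "T \<in> measurable M (count_space UNIV)"
  shows "\<P>(\<omega> in M. T \<omega> \<le> enat n) = 1 - \<P>(\<omega> in M. enat n < T \<omega>)"
proof -
  interpret prob_space M by fact
  note assms(2)[measurable]
  have "{\<omega> \<in> space M. T \<omega> \<le> enat n} = space M - {\<omega> \<in> space M. enat n < T \<omega>}"
    by auto
  then show ?thesis
    by (simp only:) (rule prob_compl, measurable)
qed

lemma sto_le_geometric_lower: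
  assumes G: "geometric_rv N G p" and M: "prob_space M"
    and T: "T \<in> measurable M (count_space UNIV)" and m: "0 < m"
    and lower: "\<And>k. (1 - p) ^ k \<le> \<P>(\<omega> in M. enat (m * k) < T \<omega>)"
  shows "sto_le N (\<lambda>\<omega>. ereal (real m * (real (G \<omega>) - 1))) M (\<lambda>\<omega>. ereal_of_enat (T \<omega>))"
  unfolding sto_le_def
proof
  fix t :: real
  interpret M: prob_space M by fact
  interpret N: prob_space N
    using G by (simp add: geometric_rv_def)
  note T[measurable]
  have G_meas: "G \<in> measurable N (count_space {1..})"
    using G by (simp add: geometric_rv_def)
  have [measurable]: "G \<in> measurable N (count_space UNIV)"
    using measurable_compose[OF G_meas, of "\<lambda>x. x" "count_space UNIV"] by simp
  \<comment> \<open>Rounding up serves both ends: \<open>T < t\<close> gives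
    \<open>T \<le> m * k\<close>, and \<open>G \<le> k\<close> gives \<open>G - 1 < t / m\<close>.
    For \<open>t \<le> 0\<close> this \<open>k\<close> is 0, and \<open>G \<le> 0\<close> is
    impossible.\<close>
  define k where "k = nat \<lceil>t / m\<rceil>"
  have t: "t \<le> real m * real k"
    using m of_nat_ceiling[of "t / m"] by (simp add: k_def field_simps)
  have "\<P>(\<omega> in M. ereal_of_enat (T \<omega>) < ereal t) \<le> \<P>(\<omega> in M. T \<omega> \<le> enat (m * k))"
  proof (intro M.finite_measure_mono subsetI)
    fix \<omega> assume "\<omega> \<in> {\<omega> \<in> space M. ereal_of_enat (T \<omega>) < ereal t}"
    then show "\<omega> \<in> {\<omega> \<in> space M. T \<omega> \<le> enat (m * k)}"
    proof (cases "T \<omega>")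
      case (enat n)
      then have "real n < real (m * k)"
        using \<open>\<omega> \<in> _\<close> t by simp
      then have "n \<le> m * k" by linarith
      with enat \<open>\<omega> \<in> _\<close> show ?thesis by simp
    qed simp
  qed measurable
  also have "\<dots> \<le> 1 - (1 - p) ^ k"
    using lower[of k] by (simp add: prob_enat_le[OF M T])
  also have "\<dots> = \<P>(\<omega> in N. G \<omega> \<le> k)"
    by (rule geometric_rv_cdf[OF G, symmetric])
  also have "\<dots> \<le> \<P>(\<omega> in N. ereal (real m * (real (G \<omega>) - 1)) < ereal t)"
  proof (intro N.finite_measure_mono subsetI)
    fix \<omega> assume \<omega>: "\<omega> \<in> {\<omega> \<in> space N. G \<omega> \<le> k}"
    then have "1 \<le> G \<omega>"
      using measurable_space[OF G_meas] by auto
    then have "1 \<le> nat \<lceil>t / m\<rceil>" "G \<omega> \<le> nat \<lceil>t / m\<rceil>"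
      using \<omega> by (auto simp: k_def)
    then have "int (G \<omega>) \<le> \<lceil>t / m\<rceil>"
      by linarith
    then have "real (G \<omega>) - 1 < t / m"
      by linarith
    then have "real m * (real (G \<omega>) - 1) < t"
      using m by (simp add: field_simps)
    with \<omega> show "\<omega> \<in> {\<omega> \<in> space N. ereal (real m * (real (G \<omega>) - 1)) < ereal t}"
      by simp
  qed simp
  finally show "\<P>(\<omega> in M. ereal_of_enat (T \<omega>) < ereal t)
      \<le> \<P>(\<omega> in N. ereal (real m * (real (G \<omega>) - 1)) < ereal t)" .
qed

lemma sto_le_geometric_upper:
  assumes G: "geometric_rv N G p" and M: "prob_space M"
    and T: "T \<in> measurable M (count_space UNIV)" and m: "0 < m"
    and upper: "\<And>k. \<P>(\<omega> in M. enat (m * k) < T \<omega>) \<le> (1 - p) ^ k"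
  shows "sto_le M (\<lambda>\<omega>. ereal_of_enat (T \<omega>)) N (\<lambda>\<omega>. ereal (real m * real (G \<omega>)))"
  unfolding sto_le_def
proof
  fix t :: real
  interpret M: prob_space M by fact
  interpret N: prob_space N
    using G by (simp add: geometric_rv_def)
  note T[measurable]
  have G_meas: "G \<in> measurable N (count_space {1..})"
    using G by (simp add: geometric_rv_def)
  have [measurable]: "G \<in> measurable N (count_space UNIV)"
    using measurable_compose[OF G_meas, of "\<lambda>x. x" "count_space UNIV"] by simp
  have G_ge: "1 \<le> G \<omega>" if "\<omega> \<in> space N" for \<omega>
    using measurable_space[OF G_meas that] by simp
  show "\<P>(\<omega> in N. ereal (real m * real (G \<omega>)) < ereal t)
      \<le> \<P>(\<omega> in M. ereal_of_enat (T \<omega>) < ereal t)"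
  proof (cases "0 < t")
    case False
    have "\<not> real m * real (G \<omega>) < t" for \<omega>
      using False by (simp add: not_less order_trans[of t 0])
    then have "{\<omega> \<in> space N. ereal (real m * real (G \<omega>)) < ereal t} = {}"
      by simp
    then show ?thesis by (simp only:) simp
  next
    case True
    \<comment> \<open>The largest integer strictly below \<open>t / m\<close>: then
      \<open>m * G < t\<close> forces \<open>G \<le> k\<close>, and \<open>T \<le> m * k\<close>
      forces \<open>T < t\<close>.\<close>
    define k where "k = nat (\<lceil>t / m\<rceil> - 1)"
    have "0 < \<lceil>t / m\<rceil>"
      using True m by simp
    then have k: "real k < t / m" "t / m \<le> real k + 1"
      unfolding k_def by linarith+
    have "\<P>(\<omega> in N. ereal (real m * real (G \<omega>)) < ereal t) \<le> \<P>(\<omega> in N. G \<omega> \<le> k)"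
    proof (intro N.finite_measure_mono subsetI)
      fix \<omega> assume \<omega>: "\<omega> \<in> {\<omega> \<in> space N. ereal (real m * real (G \<omega>)) < ereal t}"
      then have "real (G \<omega>) < t / m"
        using m by (simp add: field_simps)
      then have "G \<omega> \<le> k"
        using k by linarith
      then show "\<omega> \<in> {\<omega> \<in> space N. G \<omega> \<le> k}"
        using \<omega> by simp
    qed measurable
    also have "\<dots> = 1 - (1 - p) ^ k"
      by (rule geometric_rv_cdf[OF G])
    also have "\<dots> \<le> \<P>(\<omega> in M. T \<omega> \<le> enat (m * k))"
      using upper[of k] by (simp add: prob_enat_le[OF M T])
    also have "\<dots> \<le> \<P>(\<omega> in M. ereal_of_enat (T \<omega>) < ereal t)"
    proof (intro M.finite_measure_mono subsetI)
      fix \<omega> assume \<omega>: "\<omega> \<in> {\<omega> \<in> space M. T \<omega> \<le> enat (m * k)}"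
      then obtain n where n: "T \<omega> = enat n" "n \<le> m * k"
        by (cases "T \<omega>") auto
      have "real n \<le> real m * real k"
        using n by (metis of_nat_le_iff of_nat_mult)
      also have "\<dots> < t"
        using k m by (simp add: field_simps)
      finally show "\<omega> \<in> {\<omega> \<in> space M. ereal_of_enat (T \<omega>) < ereal t}"
        using \<omega> n by simp
    qed measurable
    finally show ?thesis .
  qed
qed

lemma nn_integral_enat_sums:
  assumes "prob_space M" and "T \<in> measurable M (count_space UNIV)"
    and "(\<lambda>n. \<P>(\<omega> in M. enat n < T \<omega>)) sums s"
  shows "(\<integral>\<^sup>+ \<omega>. ennreal_of_enat (T \<omega>) \<partial>M) = ennreal s"
proof -
  interpret prob_space M by fact
  have "(\<integral>\<^sup>+ \<omega>. ennreal_of_enat (T \<omega>) \<partial>M) = (\<Sum>n. ennreal (\<P>(\<omega> in M. enat n < T \<omega>)))"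
    using nn_integral_enat_function[OF assms(2)] by (simp add: emeasure_eq_measure)
  also have "\<dots> = ennreal s"
    using assms(3) by (intro suminf_ennreal_eq) auto
  finally show ?thesis .
qed

lemma cdf_scaled_enat:
  assumes M: "prob_space M" and T: "T \<in> measurable M (count_space UNIV)"
    and sums: "(\<lambda>n. \<P>(\<omega> in M. enat n < T \<omega>)) sums s" and s: "0 < s" and x: "0 \<le> x"
  shows "cdf (distr M borel (\<lambda>\<omega>. enn2real (ennreal_of_enat (T \<omega>) / ennreal s))) x
      = 1 - \<P>(\<omega> in M. enat (nat \<lfloor>x * s\<rfloor>) < T \<omega>)"
proof -
  interpret prob_space M by fact
  note T[measurable]
  let ?f = "\<lambda>t. enn2real (ennreal_of_enat t / ennreal s)"
  have f[measurable]: "(\<lambda>\<omega>. ?f (T \<omega>)) \<in> borel_measurable M"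
    by (rule measurable_compose[OF T]) simp
  \<comment> \<open>\<open>enn2real\<close> sends infinity to 0, so an infinite \<open>T\<close>
    would count as at most \<open>x\<close>; the finite mean excludes it almost surely.\<close>
  have "(\<integral>\<^sup>+ \<omega>. ennreal_of_enat (T \<omega>) \<partial>M) \<noteq> \<infinity>"
    using nn_integral_enat_sums[OF M T sums] by simp
  then have "AE \<omega> in M. ennreal_of_enat (T \<omega>) \<noteq> \<infinity>"
    by (intro nn_integral_noteq_infinite measurable_compose[OF T]) simp_all
  then have "AE \<omega> in M. ?f (T \<omega>) \<le> x \<longleftrightarrow> T \<omega> \<le> enat (nat \<lfloor>x * s\<rfloor>)"
  proof eventually_elim
    case (elim \<omega>)
    then obtain n where n: "T \<omega> = enat n" by (cases "T \<omega>") auto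
    have "?f (T \<omega>) = real n / s"
      using s by (simp only: n ennreal_of_enat_enat ennreal_of_nat_eq_real_of_nat)
        (simp add: divide_ennreal)
    moreover have "real n / s \<le> x \<longleftrightarrow> n \<le> nat \<lfloor>x * s\<rfloor>"
      using s x by (simp add: pos_divide_le_eq le_nat_iff le_floor_iff)
    ultimately show ?case using n by simp
  qed
  then have "\<P>(\<omega> in M. ?f (T \<omega>) \<le> x) = \<P>(\<omega> in M. T \<omega> \<le> enat (nat \<lfloor>x * s\<rfloor>))"
    by (intro prob_eq_AE) auto
  moreover have "cdf (distr M borel (\<lambda>\<omega>. ?f (T \<omega>))) x = \<P>(\<omega> in M. ?f (T \<omega>) \<le> x)"
    unfolding cdf_def
    by (subst measure_distr) (auto intro!: arg_cong[where f = prob])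
  ultimately show ?thesis
    by (simp add: prob_enat_le[OF M T])
qed

lemma cdf_exponential:
  "cdf (density lborel (\<lambda>x. ennreal (exponential_density 1 x))) x = (if x < 0 then 0 else 1 - exp (- x))"
  unfolding cdf_def measure_def
  by (subst emeasure_erlang_density) (simp_all add: erlang_CDF_def)

section \<open>Asymptotics for small epsilon\<close>

lemma exp_neg_div_tendsto_0:
  assumes "(0::real) < c"
  shows "((\<lambda>\<epsilon>. exp (- c / \<epsilon>)) \<longlongrightarrow> 0) (at_right 0)"
proof -
  have "filterlim (\<lambda>\<epsilon>. c * inverse \<epsilon>) at_top (at_right 0)"
    by (intro filterlim_tendsto_pos_mult_at_top[OF tendsto_const assms] filterlim_inverse_at_top_right)
  then have "filterlim (\<lambda>\<epsilon>. - c / \<epsilon>) at_bot (at_right 0)"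
    by (simp add: filterlim_uminus_at_top divide_inverse)
  then show ?thesis
    by (rule filterlim_compose[OF exp_at_bot])
qed

theorem theorem2:
  fixes U :: "int \<Rightarrow> real"
    and a \<alpha> \<beta> b :: int
    and M :: "real \<Rightarrow> 'a measure"
    and X V :: "real \<Rightarrow> nat \<Rightarrow> 'a \<Rightarrow> int"
    and \<tau> :: "real \<Rightarrow> 'a \<Rightarrow> enat"
    and E\<tau> :: "real \<Rightarrow> ennreal"
    and E1 E2 E3 :: real
  assumes walk: "\<And>\<epsilon>. \<epsilon> > 0 \<Longrightarrow> zigzag_walk (M \<epsilon>) (\<lambda>x. U x / \<epsilon>) (X \<epsilon>) (V \<epsilon>)"
    and init: "\<And>\<epsilon>. \<epsilon> > 0 \<Longrightarrow> AE \<omega> in M \<epsilon>. X \<epsilon> 0 \<omega> = 0 \<and> V \<epsilon> 0 \<omega> = 1"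
    and U0: "U 0 = 0"
    and U_left: "antimono_on {..0} U"
    and U_right: "mono_on {0..} U"
    and order: "a < \<alpha>" "\<alpha> \<le> 0" "0 \<le> \<beta>" "\<beta> < b"
    and zeros: "{\<alpha>..\<beta>} = {k. U k = 0}"
    and \<tau>: "\<And>\<epsilon> \<omega>. \<tau> \<epsilon> \<omega> = exit_time a b (\<lambda>n. X \<epsilon> n \<omega>)"
    and E\<tau>: "\<And>\<epsilon>. E\<tau> \<epsilon> = (\<integral>\<^sup>+ \<omega>. ennreal_of_enat (\<tau> \<epsilon> \<omega>) \<partial>M \<epsilon>)"
    and E1: "E1 = min (U a) (U b)"
    and E2: "E2 = min (U (\<alpha> - 1)) (U (\<beta> + 1))"
    and E3: "E3 = \<bar>U a - U b\<bar>"
  shows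
    "(\<exists>R1 R2 :: real \<Rightarrow> real.
        R1 \<in> O[at_right 0](\<lambda>\<epsilon>. exp (- E2 / \<epsilon>)) \<and>
        R2 \<in> O[at_right 0](\<lambda>\<epsilon>. exp (- E3 / \<epsilon>)) \<and>
        (\<forall>\<epsilon>>0. E\<tau> \<epsilon> = ennreal (exp (E1 / \<epsilon>) *
           (2 * real_of_int (\<beta> - \<alpha> + 1) / (1 + of_bool (U a = U b))
            + R1 \<epsilon> + of_bool (U a \<noteq> U b) * R2 \<epsilon>))))
     \<and> (\<forall>e. filterlim e (at_right 0) sequentially \<longrightarrow>
          weak_conv_m
            (\<lambda>n. distr (M (e n)) borel
                   (\<lambda>\<omega>. enn2real (ennreal_of_enat (\<tau> (e n) \<omega>) / E\<tau> (e n))))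
            (density lborel (\<lambda>x. ennreal (exponential_density 1 x))))
     \<and> ((\<lambda>\<epsilon>. \<P>(\<omega> in M \<epsilon>. \<tau> \<epsilon> \<omega> \<noteq> \<infinity> \<and> X \<epsilon> (the_enat (\<tau> \<epsilon> \<omega>)) \<omega> = a))
          \<longlongrightarrow> 1 / 2 * (1 + of_bool (U a \<le> U b) - of_bool (U b \<le> U a))) (at_right 0)
     \<and> (\<forall>\<epsilon>>0. \<forall>(N :: 'b measure) G.
          geometric_rv N G (exp (- U b / \<epsilon>) + exp (- U a / \<epsilon>) - exp (- (U b + U a) / \<epsilon>)) \<longrightarrow>
            sto_le N (\<lambda>\<omega>. ereal (2 * real_of_int (\<beta> - \<alpha> + 1) * (real (G \<omega>) - 1)))
                   (M \<epsilon>) (\<lambda>\<omega>. ereal_of_enat (\<tau> \<epsilon> \<omega>))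
          \<and> sto_le (M \<epsilon>) (\<lambda>\<omega>. ereal_of_enat (\<tau> \<epsilon> \<omega>))
                   N (\<lambda>\<omega>. ereal (2 * real_of_int (b - a + 1) * real (G \<omega>))))"
proof (intro conjI)
  define W where "W \<epsilon> x = U x / \<epsilon>" for \<epsilon> x
  define p where "p \<epsilon> = exp (- U b / \<epsilon>) + exp (- U a / \<epsilon>) - exp (- (U b + U a) / \<epsilon>)" for \<epsilon>
  define H where "H \<epsilon> n = survival (W \<epsilon>) a b n (0, 1)" for \<epsilon> n
  \<comment> \<open>For \<open>\<epsilon> > 0\<close> this is the \<open>loop_length\<close> of the
    well, and the mean exit time is \<open>L \<epsilon> / p \<epsilon>\<close>.\<close>
  define L where "L \<epsilon> = p \<epsilon> * suminf (H \<epsilon>)" for \<epsilon>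
  define c where "c = nat (\<beta> - \<alpha> + 1)"
  define d where "d = nat (b - a + 1)"
  define D where "D = max (U a) (U b)"
  \<comment> \<open>\<open>p \<epsilon>\<close> divided by its leading exponential
    \<open>exp (- E1 / \<epsilon>)\<close>, using \<open>U a + U b = E1 + D\<close> and
    \<open>D = E1 + E3\<close>.\<close>
  define \<sigma> where "\<sigma> \<epsilon> = 1 + exp (- E3 / \<epsilon>) - exp (- D / \<epsilon>)" for \<epsilon>

  have c: "real c = real_of_int (\<beta> - \<alpha> + 1)" "0 < c" and d: "real d = real_of_int (b - a + 1)" "0 < d"
    using order by (auto simp: c_def d_def)
  have well: "zigzag_well (W \<epsilon>) a \<alpha> \<beta> b" if "\<epsilon> > 0" for \<epsilon>
  proof
    show "antimono_on {..0} (W \<epsilon>)"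
      using that by (auto simp: W_def monotone_on_def intro!: divide_right_mono monotone_onD[OF U_left])
    show "mono_on {0..} (W \<epsilon>)"
      using that by (auto simp: W_def monotone_on_def intro!: divide_right_mono monotone_onD[OF U_right])
    show "{\<alpha>..\<beta>} = {k. W \<epsilon> k = 0}"
      using that zeros by (simp add: W_def)
  qed (use order in auto)
  have p_eq: "zigzag_well.exit_prob (W \<epsilon>) a b = p \<epsilon>" if "\<epsilon> > 0" for \<epsilon>
    using zigzag_well.exit_prob_def[OF well[OF that]] by (simp add: p_def W_def add_divide_distrib diff_divide_distrib)
  have p_bounds: "0 < p \<epsilon>" "p \<epsilon> < 1" if "\<epsilon> > 0" for \<epsilon>
    using zigzag_well.exit_prob_bounds[OF well[OF that]] p_eq[OF that] by auto
  have H_sums: "H \<epsilon> sums (L \<epsilon> / p \<epsilon>)"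
    and L_eq: "L \<epsilon> = zigzag_well.loop_length (W \<epsilon>) a b" if "\<epsilon> > 0" for \<epsilon>
  proof -
    have *: "H \<epsilon> sums (zigzag_well.loop_length (W \<epsilon>) a b / p \<epsilon>)"
      using zigzag_well.survival_sums[OF well[OF that]] p_eq[OF that] by (simp add: H_def[abs_def])
    then show "L \<epsilon> = zigzag_well.loop_length (W \<epsilon>) a b"
      using p_bounds[OF that] by (simp add: L_def sums_unique[symmetric])
    with * show "H \<epsilon> sums (L \<epsilon> / p \<epsilon>)" by simp
  qed
  have H_antimono: "antimono (H \<epsilon>)" for \<epsilon>
    unfolding H_def[abs_def] by (rule antimono_survival)
  have H_0: "H \<epsilon> 0 = 1" for \<epsilon>
    using order by (simp add: H_def survival_0)
  have H_lower: "(1 - p \<epsilon>) ^ k \<le> H \<epsilon> (2 * c * k)" if "\<epsilon> > 0" for \<epsilon> k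
    using zigzag_well.survival_lower[OF well[OF that], of k] p_eq[OF that]
    by (simp add: H_def c_def zigzag_well.plateau_def[OF well[OF that]])
  have H_upper: "H \<epsilon> (2 * d * k) \<le> (1 - p \<epsilon>) ^ k" if "\<epsilon> > 0" for \<epsilon> k
    using zigzag_well.survival_upper[OF well[OF that], of k] p_eq[OF that]
    by (simp add: H_def d_def)
  have prob: "prob_space (M \<epsilon>)" if "\<epsilon> > 0" for \<epsilon>
    by (rule zigzag_prob_space[OF walk[OF that]])
  have \<tau>_meas: "\<tau> \<epsilon> \<in> measurable (M \<epsilon>) (count_space UNIV)" if "\<epsilon> > 0" for \<epsilon>
    using exit_time_measurable[OF walk[OF that]] by (simp add: \<tau>[abs_def])
  have \<tau>_tail: "\<P>(\<omega> in M \<epsilon>. enat n < \<tau> \<epsilon> \<omega>) = H \<epsilon> n" if "\<epsilon> > 0" for \<epsilon> n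
    using prob_less_exit_time[OF walk[OF that] init[OF that]]
    by (simp add: \<tau> H_def W_def[abs_def])
  have E\<tau>_eq: "E\<tau> \<epsilon> = ennreal (L \<epsilon> / p \<epsilon>)" if "\<epsilon> > 0" for \<epsilon>
    unfolding E\<tau> by (rule nn_integral_enat_sums[OF prob[OF that] \<tau>_meas[OF that]])
      (use \<tau>_tail[OF that] H_sums[OF that] in simp)

  have U_le: "U 0 \<le> U (\<beta> + 1)" "U (\<beta> + 1) \<le> U b" "U 0 \<le> U (\<alpha> - 1)" "U (\<alpha> - 1) \<le> U a"
    using order monotone_onD[OF U_right, of 0 "\<beta> + 1"] monotone_onD[OF U_right, of "\<beta> + 1" b]
      monotone_onD[OF U_left, of "\<alpha> - 1" 0] monotone_onD[OF U_left, of a "\<alpha> - 1"] by auto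
  have "U (\<beta> + 1) \<noteq> 0" "U (\<alpha> - 1) \<noteq> 0"
    using zeros by (force simp: set_eq_iff)+
  then have E2_pos: "0 < E2"
    using U_le U0 by (auto simp: E2)
  have E2_le: "E2 \<le> E1" "E2 \<le> D" "E2 \<le> U a" "E2 \<le> U b" "E3 = D - E1" "E3 \<le> D" "0 \<le> E3"
    using U_le U0 E2_pos unfolding E1 E2 E3 D_def by (auto simp: min_def max_def)
  have pos: "\<forall>\<^sub>F \<epsilon> in at_right 0. (0::real) < \<epsilon>"
    by (simp add: eventually_at_right_less)
  have exp_le: "exp (- y / \<epsilon>) \<le> exp (- x / \<epsilon>)" if "\<epsilon> > 0" "x \<le> y" for \<epsilon> x y :: real
    using that by (simp add: divide_right_mono)
  have p_\<sigma>: "p \<epsilon> = exp (- E1 / \<epsilon>) * \<sigma> \<epsilon>" if "\<epsilon> > 0" for \<epsilon>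
  proof -
    have "exp (- E1 / \<epsilon>) * \<sigma> \<epsilon>
        = exp (- E1 / \<epsilon>) + exp (- (E1 + E3) / \<epsilon>) - exp (- (E1 + D) / \<epsilon>)"
      by (simp add: \<sigma>_def algebra_simps add_divide_distrib diff_divide_distrib flip: exp_add)
    moreover have "E1 + E3 = D" "E1 + D = U b + U a"
      by (auto simp: E1 E3 D_def)
    moreover have "exp (- E1 / \<epsilon>) + exp (- D / \<epsilon>) = exp (- U b / \<epsilon>) + exp (- U a / \<epsilon>)"
      by (auto simp: E1 D_def min_def max_def)
    ultimately show ?thesis
      by (simp add: p_def)
  qed
  have \<sigma>_ge: "1 \<le> \<sigma> \<epsilon>" if "\<epsilon> > 0" for \<epsilon>
    using exp_le[OF that, of E3 D] E2_le by (simp add: \<sigma>_def)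
  \<comment> \<open>\<open>loop_length_estimate\<close> with
    \<open>\<delta> = exp (- E2 / \<epsilon>)\<close>; its constant does not depend on
    \<open>\<epsilon>\<close>.\<close>
  obtain K where K: "\<And>\<epsilon>. \<epsilon> > 0 \<Longrightarrow> \<bar>L \<epsilon> - 2 * real c\<bar> \<le> K * exp (- E2 / \<epsilon>)"
  proof
    let ?C = "\<lambda>B::nat. 2 * real B * real B + real B"
    let ?K = "?C (nat b) + ?C (nat (- a)) + (2 * real (nat (- \<alpha>)) + 1 + ?C (nat (- a)))"
    fix \<epsilon> :: real assume \<epsilon>: "\<epsilon> > 0"
    have "exp (- W \<epsilon> (\<beta> + 1)) \<le> exp (- E2 / \<epsilon>)" "exp (- W \<epsilon> (\<alpha> - 1)) \<le> exp (- E2 / \<epsilon>)"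
      using \<epsilon> by (auto simp: W_def E2 divide_right_mono)
    moreover have "exp (- E2 / \<epsilon>) \<le> 1"
      using \<epsilon> E2_pos by simp
    ultimately show "\<bar>L \<epsilon> - 2 * real c\<bar> \<le> ?K * exp (- E2 / \<epsilon>)"
      using zigzag_well.loop_length_estimate[OF well[OF \<epsilon>]]
      unfolding L_eq[OF \<epsilon>] c_def zigzag_well.plateau_def[OF well[OF \<epsilon>]] by blast
  qed

  show "\<exists>R1 R2 :: real \<Rightarrow> real.
        R1 \<in> O[at_right 0](\<lambda>\<epsilon>. exp (- E2 / \<epsilon>)) \<and>
        R2 \<in> O[at_right 0](\<lambda>\<epsilon>. exp (- E3 / \<epsilon>)) \<and>
        (\<forall>\<epsilon>>0. E\<tau> \<epsilon> = ennreal (exp (E1 / \<epsilon>) *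
           (2 * real_of_int (\<beta> - \<alpha> + 1) / (1 + of_bool (U a = U b))
            + R1 \<epsilon> + of_bool (U a \<noteq> U b) * R2 \<epsilon>)))"
  proof -
    have E\<tau>_\<sigma>: "E\<tau> \<epsilon> = ennreal (exp (E1 / \<epsilon>) * (L \<epsilon> / \<sigma> \<epsilon>))" if "\<epsilon> > 0" for \<epsilon>
      using E\<tau>_eq[OF that] p_\<sigma>[OF that] \<sigma>_ge[OF that] by (simp add: exp_minus field_simps)
    \<comment> \<open>The remainder of \<open>L \<epsilon> / \<sigma> \<epsilon>\<close> after
      subtracting its limit \<open>k\<close>: \<open>k = c\<close> in a tie, where
      \<open>\<sigma> \<epsilon> = 2 - exp (- D / \<epsilon>)\<close>, and \<open>k = 2 * c\<close>
      otherwise, where the term with \<open>E3\<close> is left to \<open>R2\<close>. As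
      \<open>E2 \<le> D\<close>, the term with \<open>D\<close> is absorbed by the error in
      \<open>E2\<close>.\<close>
    define R where "R k \<epsilon> = (L \<epsilon> - 2 * real c + k * exp (- D / \<epsilon>)) / \<sigma> \<epsilon>" for k \<epsilon>
    have R_bigo: "R k \<in> O[at_right 0](\<lambda>\<epsilon>. exp (- E2 / \<epsilon>))" if "0 \<le> k" for k
    proof (rule bigoI)
      show "\<forall>\<^sub>F \<epsilon> in at_right 0. norm (R k \<epsilon>) \<le> (K + k) * norm (exp (- E2 / \<epsilon>))"
        using pos
      proof eventually_elim
        case (elim \<epsilon>)
        have "norm (R k \<epsilon>) \<le> \<bar>L \<epsilon> - 2 * real c + k * exp (- D / \<epsilon>)\<bar>"
          using \<sigma>_ge[OF elim] by (simp add: R_def abs_div_pos[symmetric] divide_le_eq mult_left_le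
              mult_le_cancel_left1)
        also have "\<dots> \<le> K * exp (- E2 / \<epsilon>) + k * exp (- D / \<epsilon>)"
          using K[OF elim] that by (intro order_trans[OF abs_triangle_ineq] add_mono) auto
        also have "\<dots> \<le> (K + k) * exp (- E2 / \<epsilon>)"
          using mult_left_mono[OF exp_le[OF elim E2_le(2)] that] by (simp add: distrib_right)
        finally show ?case by simp
      qed
    qed
    show ?thesis
    proof (cases "U a = U b")
      case True
      then have \<sigma>: "\<sigma> \<epsilon> = 2 - exp (- D / \<epsilon>)" for \<epsilon>
        by (simp add: \<sigma>_def E3)
      have "L \<epsilon> / \<sigma> \<epsilon> = real c + R (real c) \<epsilon>" if "\<epsilon> > 0" for \<epsilon>
      proof -
        have "L \<epsilon> = real c * \<sigma> \<epsilon> + (L \<epsilon> - 2 * real c + real c * exp (- D / \<epsilon>))"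
          by (simp add: \<sigma> algebra_simps)
        moreover have "\<sigma> \<epsilon> \<noteq> 0"
          using \<sigma>_ge[OF that] by simp
        ultimately show ?thesis
          unfolding R_def by (metis add_divide_distrib nonzero_mult_div_cancel_right)
      qed
      then have "\<forall>\<epsilon>>0. E\<tau> \<epsilon> = ennreal (exp (E1 / \<epsilon>) *
           (2 * real_of_int (\<beta> - \<alpha> + 1) / (1 + of_bool (U a = U b))
            + R (real c) \<epsilon> + of_bool (U a \<noteq> U b) * 0))"
        unfolding c(1)[symmetric] using True E\<tau>_\<sigma> by simp
      then show ?thesis
        using R_bigo[of "real c"] by (intro exI[of _ "R (real c)"] exI[of _ "\<lambda>_. 0"]) auto
    next
      case False
      define R2 where "R2 \<epsilon> = - 2 * real c * exp (- E3 / \<epsilon>) / \<sigma> \<epsilon>" for \<epsilon>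
      have "R2 \<in> O[at_right 0](\<lambda>\<epsilon>. exp (- E3 / \<epsilon>))"
      proof (rule bigoI)
        show "\<forall>\<^sub>F \<epsilon> in at_right 0. norm (R2 \<epsilon>) \<le> 2 * real c * norm (exp (- E3 / \<epsilon>))"
          using pos
        proof eventually_elim
          case (elim \<epsilon>)
          have "2 * real c * exp (- E3 / \<epsilon>) * 1 \<le> 2 * real c * exp (- E3 / \<epsilon>) * \<sigma> \<epsilon>"
            using \<sigma>_ge[OF elim] by (intro mult_left_mono) auto
          then have "2 * real c * exp (- E3 / \<epsilon>) / \<sigma> \<epsilon> \<le> 2 * real c * exp (- E3 / \<epsilon>)"
            using \<sigma>_ge[OF elim] by (subst pos_divide_le_eq) auto
          then show ?case
            using \<sigma>_ge[OF elim] by (simp add: R2_def abs_mult)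
        qed
      qed
      moreover have "L \<epsilon> / \<sigma> \<epsilon> = 2 * real c + R (2 * real c) \<epsilon> + R2 \<epsilon>" if "\<epsilon> > 0" for \<epsilon>
      proof -
        have "2 * real c * \<sigma> \<epsilon> + (L \<epsilon> - 2 * real c + 2 * real c * exp (- D / \<epsilon>))
            + - 2 * real c * exp (- E3 / \<epsilon>) = L \<epsilon>"
          by (simp add: \<sigma>_def algebra_simps)
        moreover have "\<sigma> \<epsilon> \<noteq> 0"
          using \<sigma>_ge[OF that] by simp
        ultimately show ?thesis
          unfolding R_def R2_def by (metis add_divide_distrib nonzero_mult_div_cancel_right)
      qed
      then have "\<forall>\<epsilon>>0. E\<tau> \<epsilon> = ennreal (exp (E1 / \<epsilon>) *
           (2 * real_of_int (\<beta> - \<alpha> + 1) / (1 + of_bool (U a = U b))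
            + R (2 * real c) \<epsilon> + of_bool (U a \<noteq> U b) * R2 \<epsilon>))"
        unfolding c(1)[symmetric] using False E\<tau>_\<sigma> by simp
      ultimately show ?thesis
        using R_bigo[of "2 * real c"] by (intro exI[of _ "R (2 * real c)"] exI[of _ R2]) auto
    qed
  qed

  have exp_0: "((\<lambda>\<epsilon>. exp (- x / \<epsilon>)) \<longlongrightarrow> 0) (at_right 0)" if "E2 \<le> x" for x
    using exp_neg_div_tendsto_0 that E2_pos by force
  have L_lim: "(L \<longlongrightarrow> 2 * real c) (at_right 0)"
  proof (rule LIM_zero_cancel, rule Lim_null_comparison)
    show "\<forall>\<^sub>F \<epsilon> in at_right 0. norm (L \<epsilon> - 2 * real c) \<le> K * exp (- E2 / \<epsilon>)"
      using pos by eventually_elim (use K in auto)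
    show "((\<lambda>\<epsilon>. K * exp (- E2 / \<epsilon>)) \<longlongrightarrow> 0) (at_right 0)"
      using tendsto_mult_left[OF exp_0[OF order_refl], of K] by simp
  qed
  have p_lim: "(p \<longlongrightarrow> 0) (at_right 0)"
  proof -
    have "(p \<longlongrightarrow> 0 + 0 - 0) (at_right 0)"
      unfolding p_def using E2_le E2_pos by (intro tendsto_add tendsto_diff exp_0) auto
    then show ?thesis by simp
  qed
  \<comment> \<open>The block length \<open>2 * c\<close> of the lower bound, which is the shortest
    loop, is also the limit of the mean loop length \<open>L\<close>; this equality makes
    \<open>exponential_limit\<close> applicable.\<close>
  have tail_lim: "((\<lambda>\<epsilon>. H \<epsilon> (nat \<lfloor>t * (L \<epsilon> / p \<epsilon>)\<rfloor>)) \<longlongrightarrow> exp (- t)) (at_right 0)" if "0 \<le> t" for t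
  proof (rule exponential_limit[where C = "2 * c" and p = p])
    show "\<forall>\<^sub>F \<epsilon> in at_right 0. 0 < p \<epsilon> \<and> p \<epsilon> < 1"
      using pos by eventually_elim (use p_bounds in auto)
    show "\<forall>\<^sub>F \<epsilon> in at_right 0. antimono (H \<epsilon>) \<and> H \<epsilon> 0 = 1 \<and> H \<epsilon> sums (L \<epsilon> / p \<epsilon>)"
      using pos by eventually_elim (use H_antimono H_0 H_sums in auto)
    show "\<forall>\<^sub>F \<epsilon> in at_right 0. \<forall>k. (1 - p \<epsilon>) ^ k \<le> H \<epsilon> (2 * c * k)"
      using pos by eventually_elim (use H_lower in auto)
    have "\<forall>\<^sub>F \<epsilon> in at_right 0. L \<epsilon> = p \<epsilon> * (L \<epsilon> / p \<epsilon>)"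
      using pos by eventually_elim (use p_bounds in force)
    with L_lim show "((\<lambda>\<epsilon>. p \<epsilon> * (L \<epsilon> / p \<epsilon>)) \<longlongrightarrow> real (2 * c)) (at_right 0)"
      by (simp add: tendsto_cong)
  qed (use c that p_lim in auto)
  have L_pos: "\<forall>\<^sub>F \<epsilon> in at_right 0. 0 < L \<epsilon>"
    using order_tendstoD(1)[OF L_lim, of 0] c by simp
  show "\<forall>e. filterlim e (at_right 0) sequentially \<longrightarrow>
          weak_conv_m
            (\<lambda>n. distr (M (e n)) borel
                   (\<lambda>\<omega>. enn2real (ennreal_of_enat (\<tau> (e n) \<omega>) / E\<tau> (e n))))
            (density lborel (\<lambda>x. ennreal (exponential_density 1 x)))"
  proof (intro allI impI)
    fix e :: "nat \<Rightarrow> real"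
    assume e: "filterlim e (at_right 0) sequentially"
    let ?F = "\<lambda>\<epsilon>. distr (M \<epsilon>) borel (\<lambda>\<omega>. enn2real (ennreal_of_enat (\<tau> \<epsilon> \<omega>) / E\<tau> \<epsilon>))"
    have "((\<lambda>\<epsilon>. cdf (?F \<epsilon>) x)
        \<longlongrightarrow> cdf (density lborel (\<lambda>x. ennreal (exponential_density 1 x))) x) (at_right 0)" for x
    proof (cases "x < 0")
      case True
      have "cdf (?F \<epsilon>) x = 0" if "\<epsilon> > 0" for \<epsilon>
      proof -
        interpret prob_space "M \<epsilon>" by (rule prob[OF that])
        have meas: "(\<lambda>\<omega>. enn2real (ennreal_of_enat (\<tau> \<epsilon> \<omega>) / E\<tau> \<epsilon>)) \<in> borel_measurable (M \<epsilon>)"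
          by (rule measurable_compose[OF \<tau>_meas[OF that]]) simp
        have "\<not> enn2real (ennreal_of_enat (\<tau> \<epsilon> \<omega>) / E\<tau> \<epsilon>) \<le> x" for \<omega>
          using True enn2real_nonneg[of "ennreal_of_enat (\<tau> \<epsilon> \<omega>) / E\<tau> \<epsilon>"] by linarith
        then show ?thesis
          unfolding cdf_def by (subst measure_distr[OF meas]) (auto simp: vimage_def)
      qed
      then have "\<forall>\<^sub>F \<epsilon> in at_right 0. cdf (?F \<epsilon>) x = 0"
        using pos by (auto elim!: eventually_mono)
      then show ?thesis
        unfolding cdf_exponential using True by (simp add: tendsto_eventually)
    next
      case False
      have "((\<lambda>\<epsilon>. 1 - H \<epsilon> (nat \<lfloor>x * (L \<epsilon> / p \<epsilon>)\<rfloor>)) \<longlongrightarrow> 1 - exp (- x)) (at_right 0)"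
        using False by (intro tendsto_diff tendsto_const tail_lim) auto
      moreover have "\<forall>\<^sub>F \<epsilon> in at_right 0. 1 - H \<epsilon> (nat \<lfloor>x * (L \<epsilon> / p \<epsilon>)\<rfloor>) = cdf (?F \<epsilon>) x"
        using pos L_pos
      proof eventually_elim
        case (elim \<epsilon>)
        have "(\<lambda>n. \<P>(\<omega> in M \<epsilon>. enat n < \<tau> \<epsilon> \<omega>)) sums (L \<epsilon> / p \<epsilon>)"
          using H_sums[OF elim(1)] \<tau>_tail[OF elim(1)] by simp
        from cdf_scaled_enat[OF prob[OF elim(1)] \<tau>_meas[OF elim(1)] this, of x] show ?case
          using False elim p_bounds[OF elim(1)] \<tau>_tail[OF elim(1)] by (simp add: E\<tau>_eq)
      qed
      ultimately have "((\<lambda>\<epsilon>. cdf (?F \<epsilon>) x) \<longlongrightarrow> 1 - exp (- x)) (at_right 0)"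
        by (rule Lim_transform_eventually)
      then show ?thesis
        unfolding cdf_exponential using False by simp
    qed
    then show "weak_conv_m (\<lambda>n. ?F (e n)) (density lborel (\<lambda>x. ennreal (exponential_density 1 x)))"
      unfolding weak_conv_m_def weak_conv_def using filterlim_compose[OF _ e] by blast
  qed

  show "((\<lambda>\<epsilon>. \<P>(\<omega> in M \<epsilon>. \<tau> \<epsilon> \<omega> \<noteq> \<infinity> \<and> X \<epsilon> (the_enat (\<tau> \<epsilon> \<omega>)) \<omega> = a))
          \<longlongrightarrow> 1 / 2 * (1 + of_bool (U a \<le> U b) - of_bool (U b \<le> U a))) (at_right 0)"
  proof -
    let ?P = "\<lambda>\<epsilon>. \<P>(\<omega> in M \<epsilon>. \<tau> \<epsilon> \<omega> \<noteq> \<infinity> \<and> X \<epsilon> (the_enat (\<tau> \<epsilon> \<omega>)) \<omega> = a)"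
    have P_eq: "?P \<epsilon> = (1 - exp (- U b / \<epsilon>)) * exp (- (U a - E1) / \<epsilon>) / \<sigma> \<epsilon>" if "\<epsilon> > 0" for \<epsilon>
    proof -
      have "(\<lambda>n. exit_low (W \<epsilon>) a b n (0, 1)) \<longlonglongrightarrow> ?P \<epsilon>"
        using prob_exit_low[OF walk[OF that] init[OF that], of a b]
        by (simp add: \<tau> W_def[abs_def])
      then have "?P \<epsilon> = (1 - exp (- W \<epsilon> b)) * exp (- W \<epsilon> a) / p \<epsilon>"
        using zigzag_well.exit_low_tendsto[OF well[OF that]] p_eq[OF that]
        by (auto dest: LIMSEQ_unique)
      also have "exp (- W \<epsilon> a) = exp (- E1 / \<epsilon>) * exp (- (U a - E1) / \<epsilon>)"
        by (simp add: W_def diff_divide_distrib flip: exp_add)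
      finally show ?thesis
        by (simp add: p_\<sigma>[OF that] W_def)
    qed
    \<comment> \<open>The source of the indicators: \<open>exp (- x / \<epsilon>)\<close> is
      constantly 1 at \<open>x = 0\<close> and vanishes in the limit for positive
      \<open>x\<close>.\<close>
    have of_bool_lim: "((\<lambda>\<epsilon>. exp (- x / \<epsilon>)) \<longlongrightarrow> of_bool (x = 0)) (at_right 0)" if "0 \<le> x" for x :: real
      using exp_neg_div_tendsto_0[of x] that by (cases "x = 0") auto
    have lim: "((\<lambda>\<epsilon>. (1 - exp (- U b / \<epsilon>)) * exp (- (U a - E1) / \<epsilon>) / \<sigma> \<epsilon>)
        \<longlongrightarrow> (1 - 0) * of_bool (U a - E1 = 0) / (1 + of_bool (E3 = 0) - 0)) (at_right 0)"
      unfolding \<sigma>_def using E2_le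
      by (intro tendsto_divide tendsto_mult tendsto_diff tendsto_add tendsto_const exp_0 of_bool_lim)
         (auto simp: E1)
    \<comment> \<open>The common value is 1, 1/2 or 0 according as \<open>U a\<close> is less than,
      equal to or greater than \<open>U b\<close>.\<close>
    have val: "(1 - 0) * of_bool (U a - E1 = 0) / (1 + of_bool (E3 = 0) - 0)
        = 1 / 2 * (1 + of_bool (U a \<le> U b) - of_bool (U b \<le> U a) :: real)"
      by (auto simp: E1 E3 min_def)
    have ev: "\<forall>\<^sub>F \<epsilon> in at_right 0. (1 - exp (- U b / \<epsilon>)) * exp (- (U a - E1) / \<epsilon>) / \<sigma> \<epsilon> = ?P \<epsilon>"
      using pos by eventually_elim (rule P_eq[symmetric])
    show ?thesis
      by (rule Lim_transform_eventually[OF lim[unfolded val] ev])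
  qed

  show "\<forall>\<epsilon>>0. \<forall>(N :: 'b measure) G.
          geometric_rv N G (exp (- U b / \<epsilon>) + exp (- U a / \<epsilon>) - exp (- (U b + U a) / \<epsilon>)) \<longrightarrow>
            sto_le N (\<lambda>\<omega>. ereal (2 * real_of_int (\<beta> - \<alpha> + 1) * (real (G \<omega>) - 1)))
                   (M \<epsilon>) (\<lambda>\<omega>. ereal_of_enat (\<tau> \<epsilon> \<omega>))
          \<and> sto_le (M \<epsilon>) (\<lambda>\<omega>. ereal_of_enat (\<tau> \<epsilon> \<omega>))
                   N (\<lambda>\<omega>. ereal (2 * real_of_int (b - a + 1) * real (G \<omega>)))"
  proof (intro allI impI)
    fix \<epsilon> :: real and N :: "'b measure" and G
    assume \<epsilon>: "\<epsilon> > 0"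
      and "geometric_rv N G (exp (- U b / \<epsilon>) + exp (- U a / \<epsilon>) - exp (- (U b + U a) / \<epsilon>))"
    then have G: "geometric_rv N G (p \<epsilon>)"
      by (simp add: p_def)
    have m: "2 * real_of_int (\<beta> - \<alpha> + 1) = real (2 * c)" "2 * real_of_int (b - a + 1) = real (2 * d)"
      unfolding c(1)[symmetric] d(1)[symmetric] by simp_all
    show "sto_le N (\<lambda>\<omega>. ereal (2 * real_of_int (\<beta> - \<alpha> + 1) * (real (G \<omega>) - 1)))
                   (M \<epsilon>) (\<lambda>\<omega>. ereal_of_enat (\<tau> \<epsilon> \<omega>))
          \<and> sto_le (M \<epsilon>) (\<lambda>\<omega>. ereal_of_enat (\<tau> \<epsilon> \<omega>))
                   N (\<lambda>\<omega>. ereal (2 * real_of_int (b - a + 1) * real (G \<omega>)))"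
      unfolding m using c d H_lower[OF \<epsilon>] H_upper[OF \<epsilon>] \<tau>_tail[OF \<epsilon>]
      by (intro conjI sto_le_geometric_lower[OF G prob[OF \<epsilon>] \<tau>_meas[OF \<epsilon>]]
          sto_le_geometric_upper[OF G prob[OF \<epsilon>] \<tau>_meas[OF \<epsilon>]]) simp_all
  qed
qed

end
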